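(* Let $k\ge3$. For $n\ge0$ let $ud(n)$ and $uu(n)$ be the numbers of up-down, respectively up-up, permutations of length $n$ that contain $1\mbox{-}3\mbox{-}2$ exactly once and avoid $2\mbox{-}1\mbox{-}3\mbox{-}\cdots\mbox{-}k$. Writing $U_r$ for $U_r\!\left(\frac1{2x}\right)$, (1) $\displaystyle\sum_{n\ge0}ud(n)x^n=\frac{1}{U_{k-1}^2}\left(\sum_{j=0}^{k-3}U_{j+1}U_j-x\right)$; (2) $\displaystyle\sum_{n\ge0}uu(n)x^n=\frac{1}{xU_{k-1}^2}\left(xU_{k-4}U_{k-2}+\sum_{j=0}^{k-4}U_jU_{j+1}\right)$.
   Context: A permutation of length $n$ is a word $\pi_1\cdots\pi_n$ containing each of $1,\dots,n$ exactly once. A classical pattern $\tau$ of length $m$ (written with dashes) occurs in $\pi$ at indices $i_1<\dots<i_m$ if $\pi_{i_1}\cdots\pi_{i_m}$ is order-isomorphic to $\tau$; containing $\tau$ exactly once means there is exactly one such tuple, avoiding means there is none. $1\mbox{-}3\mbox{-}2$ is the pattern $132$ and $2\mbox{-}1\mbox{-}3\mbox{-}\cdots\mbox{-}k$ is the permutation $2\,1\,3\,4\cdots k$. For $n\ge2$: up-down permutations satisfy $\pi_1<\pi_2>\pi_3<\cdots$ with $n$ odd; up-up ones satisfy $\pi_1<\pi_2>\pi_3<\cdots$ with $n$ even; for $n=0,1$ there are none. $U_r$ is the Chebyshev polynomial of the second kind, $U_r(\cos\theta)=\sin((r+1)\theta)/\sin\theta$; $U_{-1}=0$, $U_0=1$,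 $U_1(t)=2t$, $U_r(t)=2tU_{r-1}(t)-U_{r-2}(t)$. *)

theory Defs
  imports
    Complex_Main
    "HOL-Computational_Algebra.Computational_Algebra"
    "HOL-Combinatorics.Multiset_Permutations"
begin

text \<open>
  Permutations of length \<open>n\<close> are words, i.e. elements of \<open>permutations_of_set {1..n}\<close>.
  List positions start at 0, so the letter usually written \<open>\<pi>\<^sub>i\<close> is \<open>\<pi> ! (i - 1)\<close>.
\<close>

definition order_isomorphic :: "nat list \<Rightarrow> nat list \<Rightarrow> bool" where
  "order_isomorphic u v \<longleftrightarrow> length u = length v \<and>
     (\<forall>a < length u. \<forall>b < length u. u ! a < u ! b \<longleftrightarrow> v ! a < v ! b)"

text \<open>An occurrence is the increasing list of the positions used.\<close>

definition occurrences :: "nat list \<Rightarrow> nat list \<Rightarrow> nat list set" where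
  "occurrences \<tau> \<pi> = {is. sorted_wrt (<) is \<and> set is \<subseteq> {..<length \<pi>} \<and>
                            order_isomorphic (map (\<lambda>i. \<pi> ! i) is) \<tau>}"

definition contains_exactly_once :: "nat list \<Rightarrow> nat list \<Rightarrow> bool" where
  "contains_exactly_once \<pi> \<tau> \<longleftrightarrow> card (occurrences \<tau> \<pi>) = 1"

definition avoids :: "nat list \<Rightarrow> nat list \<Rightarrow> bool" where
  "avoids \<pi> \<tau> \<longleftrightarrow> occurrences \<tau> \<pi> = {}"

definition pattern_132 :: "nat list" where
  "pattern_132 = [1, 3, 2]"

definition pattern_213k :: "nat \<Rightarrow> nat list" where
  "pattern_213k k = [2, 1] @ [3..<Suc k]"

text \<open>\<open>\<pi>\<^sub>1 < \<pi>\<^sub>2 > \<pi>\<^sub>3 < \<dots>\<close>: ascents at the even 0-based positions.\<close>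

definition alternating_up :: "nat list \<Rightarrow> bool" where
  "alternating_up \<pi> \<longleftrightarrow> (\<forall>i. Suc i < length \<pi> \<longrightarrow>
     (if even i then \<pi> ! i < \<pi> ! Suc i else \<pi> ! i > \<pi> ! Suc i))"

definition up_down :: "nat list \<Rightarrow> bool" where
  "up_down \<pi> \<longleftrightarrow> length \<pi> \<ge> 2 \<and> odd (length \<pi>) \<and> alternating_up \<pi>"

definition up_up :: "nat list \<Rightarrow> bool" where
  "up_up \<pi> \<longleftrightarrow> length \<pi> \<ge> 2 \<and> even (length \<pi>) \<and> alternating_up \<pi>"

definition ud :: "nat \<Rightarrow> nat \<Rightarrow> nat" where
  "ud k n = card {\<pi> \<in> permutations_of_set {1..n}. up_down \<pi> \<and>
      contains_exactly_once \<pi> pattern_132 \<and> avoids \<pi> (pattern_213k k)}"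

definition uu :: "nat \<Rightarrow> nat \<Rightarrow> nat" where
  "uu k n = card {\<pi> \<in> permutations_of_set {1..n}. up_up \<pi> \<and>
      contains_exactly_once \<pi> pattern_132 \<and> avoids \<pi> (pattern_213k k)}"

text \<open>
  Chebyshev polynomials of the second kind, with an integer index so that
  \<open>U\<^sub>-\<^sub>1 = 0\<close> is included; the value 0 at indices below \<open>-1\<close> is a dummy.
\<close>

function cheb_U :: "int \<Rightarrow> 'a::comm_ring_1 poly" where
  "cheb_U r = (if r \<le> -1 then 0 else if r = 0 then 1
               else [:0, 2:] * cheb_U (r - 1) - cheb_U (r - 2))"
  by auto
termination by (relation "measure nat") auto

declare cheb_U.simps [simp del]

lemma cheb_U_minus_1: "cheb_U (-1) = 0"
  and cheb_U_0: "cheb_U 0 = 1"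
  and cheb_U_1: "cheb_U 1 = [:0, 2:]"
  and cheb_U_rec: "r \<ge> 1 \<Longrightarrow> cheb_U r = [:0, 2:] * cheb_U (r - 1) - cheb_U (r - 2)"
  by (simp_all add: cheb_U.simps)

lemma cheb_U_cos:
  assumes "r \<ge> -1"
  shows "poly (cheb_U r) (cos \<theta>) * sin \<theta> = sin ((of_int r + 1) * \<theta> :: real)"
  using assms
proof (induction r rule: cheb_U.induct)
  case (1 r)
  consider "r = -1" | "r = 0" | "r \<ge> 1" using "1.prems" by linarith
  then show ?case
  proof cases
    case 3
    then have IH1: "poly (cheb_U (r - 1)) (cos \<theta>) * sin \<theta> = sin (of_int r * \<theta>)"
      and IH2: "poly (cheb_U (r - 2)) (cos \<theta>) * sin \<theta> = sin ((of_int r - 1) * \<theta>)"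
      using 1(1,2) by (auto simp: algebra_simps)
    have "poly (cheb_U r) (cos \<theta>) * sin \<theta> =
        2 * cos \<theta> * (poly (cheb_U (r - 1)) (cos \<theta>) * sin \<theta>) - poly (cheb_U (r - 2)) (cos \<theta>) * sin \<theta>"
      by (simp add: cheb_U_rec[OF 3] algebra_simps)
    also have "\<dots> = sin ((of_int r + 1) * \<theta>)"
      unfolding IH1 IH2 by (simp add: distrib_right left_diff_distrib sin_add sin_diff)
    finally show ?thesis .
  qed (simp_all add: cheb_U_minus_1 cheb_U_0)
qed

text \<open>
  \<open>U\<^sub>r(1/(2x))\<close> is a polynomial in \<open>1/x\<close>; it is read in the field of formal Laurent
  series in \<open>x\<close>, where the generating functions also live.
\<close>

definition Uhat :: "int \<Rightarrow> rat fls" where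
  "Uhat r = poly (cheb_U r) (1 / (2 * fls_X))"

end

theory Submission
  imports Defs "HOL-Library.Sublist"
begin

text \<open>
  Write an alternating permutation as \<open>L M R\<close>, split at its maximum \<open>M\<close>; then \<open>L\<close> has odd length,
  and \<open>L\<close>, \<open>R\<close> are again alternating. If every letter of \<open>L\<close> exceeds every letter of \<open>R\<close>, then a
  copy of a pattern whose first letter is below its last lies entirely in \<open>L M\<close> or in \<open>R\<close>. Hence the
  copies of \<open>1-3-2\<close> are those in \<open>L\<close> and those in \<open>R\<close>, and \<open>2-1-3-\<dots>-k\<close> is avoided iff \<open>L\<close> avoids
  \<open>2-1-3-\<dots>-(k-1)\<close> and \<open>R\<close> avoids \<open>2-1-3-\<dots>-k\<close>. Otherwise the single copy of \<open>1-3-2\<close> is some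
  \<open>l M r\<close>, which forces \<open>L = L' l\<close> with \<open>R - {r} < l < r < L'\<close>.

  For the generating functions \<open>A\<^sub>k\<close>, \<open>C\<^sub>k\<close> of odd length with no, respectively one, copy of
  \<open>1-3-2\<close>, and \<open>D\<^sub>k\<close> of even length with one, this gives
  \<open>A\<^sub>k = x / (1 - x A\<^sub>k\<^sub>-\<^sub>1) = U\<^sub>k\<^sub>-\<^sub>2 / U\<^sub>k\<^sub>-\<^sub>1\<close> from \<open>A\<^sub>2 = x\<close>,
  \<open>C\<^sub>k = A\<^sub>k\<^sup>2 (C\<^sub>k\<^sub>-\<^sub>1 + A\<^sub>k\<^sub>-\<^sub>1)\<close> from \<open>C\<^sub>3 = x\<^sup>2 A\<^sub>3\<close>, and \<open>D\<^sub>k = C\<^sub>k / x - A\<^sub>k\<^sub>-\<^sub>1 A\<^sub>k\<close>.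
  Hence \<open>U\<^sub>k\<^sub>-\<^sub>1\<^sup>2 C\<^sub>k\<close> telescopes, and \<open>D\<^sub>k\<close> follows with the Cassini identity
  \<open>U\<^sub>r\<^sup>2 - U\<^sub>r\<^sub>-\<^sub>1 U\<^sub>r\<^sub>+\<^sub>1 = 1\<close>.
\<close>

section \<open>Copies of a pattern\<close>

definition copies :: "nat list \<Rightarrow> nat list \<Rightarrow> nat list set" where
  "copies \<tau> xs = {v. subseq v xs \<and> order_isomorphic v \<tau>}"

lemma set_subseq: "subseq xs ys \<Longrightarrow> set xs \<subseteq> set ys"
  by (auto elim: list_emb_set)

lemma subseq_mapE:
  assumes "subseq v (map f xs)"
  obtains u where "subseq u xs" "v = map f u"
  using assms by (auto simp: subseq_conv_nths nths_map)

lemma subseq_upt_iff: "subseq is [0..<n] \<longleftrightarrow> sorted_wrt (<) is \<and> set is \<subseteq> {..<n}"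
proof
  assume "subseq is [0..<n]"
  moreover from this obtain N where "is = nths [0..<n] N"
    by (auto simp: subseq_conv_nths)
  ultimately show "sorted_wrt (<) is \<and> set is \<subseteq> {..<n}"
    using set_subseq[of "is" "[0..<n]"]
    by (auto simp: strict_sorted_iff sorted_nths intro: distinct_nthsI)
next
  assume "sorted_wrt (<) is \<and> set is \<subseteq> {..<n}"
  then show "subseq is [0..<n]"
    by (intro sorted_subset_imp_subseq) (auto simp: strict_sorted_iff)
qed

lemma subseq_append_Cons_iff:
  "subseq v (xs @ x # ys) \<longleftrightarrow>
     subseq v (xs @ ys) \<or> (\<exists>v1 v2. v = v1 @ x # v2 \<and> subseq v1 xs \<and> subseq v2 ys)"
proof
  assume "subseq v (xs @ x # ys)"
  then obtain v1 v2 where v: "v = v1 @ v2" "subseq v1 xs" "subseq v2 (x # ys)"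
    by (rule subseq_appendE)
  show "subseq v (xs @ ys) \<or> (\<exists>v1 v2. v = v1 @ x # v2 \<and> subseq v1 xs \<and> subseq v2 ys)"
  proof (cases "subseq v2 ys")
    case False
    with v(3) obtain v2' where "v2 = x # v2'" "subseq v2' ys"
      by (cases v2) (auto split: if_splits)
    with v show ?thesis by blast
  qed (use v in \<open>auto simp: subseq_append_iff\<close>)
next
  have "subseq (xs @ ys) (xs @ x # ys)"
    by (simp add: subseq_append' list_emb_Cons)
  moreover assume "subseq v (xs @ ys) \<or> (\<exists>v1 v2. v = v1 @ x # v2 \<and> subseq v1 xs \<and> subseq v2 ys)"
  ultimately show "subseq v (xs @ x # ys)"
    by (elim disjE exE conjE) (blast intro: subseq_order.order_trans, simp add: list_emb_append_mono)
qed

lemma bij_betw_occurrences_copies: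
  assumes "distinct \<pi>"
  shows "bij_betw (map ((!) \<pi>)) (occurrences \<tau> \<pi>) (copies \<tau> \<pi>)"
proof (rule bij_betw_imageI)
  have map_positions: "map ((!) \<pi>) [0..<length \<pi>] = \<pi>"
    by (simp add: map_nth)
  have occurrences_eq:
    "occurrences \<tau> \<pi> = {u. subseq u [0..<length \<pi>] \<and> order_isomorphic (map ((!) \<pi>) u) \<tau>}"
    by (auto simp: occurrences_def subseq_upt_iff)
  show "map ((!) \<pi>) ` occurrences \<tau> \<pi> = copies \<tau> \<pi>"
  proof (intro equalityI subsetI)
    fix v assume "v \<in> map ((!) \<pi>) ` occurrences \<tau> \<pi>"
    then show "v \<in> copies \<tau> \<pi>"
      using subseq_map[of _ "[0..<length \<pi>]" "(!) \<pi>"]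
      by (auto simp: occurrences_eq copies_def map_positions)
  next
    fix v assume v: "v \<in> copies \<tau> \<pi>"
    then have "subseq v (map ((!) \<pi>) [0..<length \<pi>])"
      by (simp add: copies_def map_positions)
    with v show "v \<in> map ((!) \<pi>) ` occurrences \<tau> \<pi>"
      by (auto simp: occurrences_eq copies_def elim!: subseq_mapE)
  qed
  show "inj_on (map ((!) \<pi>)) (occurrences \<tau> \<pi>)"
  proof (rule inj_onI)
    fix u v
    assume uv: "u \<in> occurrences \<tau> \<pi>" "v \<in> occurrences \<tau> \<pi>" "map ((!) \<pi>) u = map ((!) \<pi>) v"
    then have "inj_on ((!) \<pi>) (set u \<union> set v)"
      using assms by (intro inj_on_nth) (auto simp: occurrences_def)
    with uv(3) show "u = v"
      by (simp add: inj_on_map_eq_map)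
  qed
qed

lemma contains_exactly_once_iff_card_copies:
  assumes "distinct \<pi>"
  shows "contains_exactly_once \<pi> \<tau> \<longleftrightarrow> card (copies \<tau> \<pi>) = 1"
  by (simp add: contains_exactly_once_def bij_betw_same_card[OF bij_betw_occurrences_copies[OF assms]])

lemma avoids_iff_copies_empty:
  assumes "distinct \<pi>"
  shows "avoids \<pi> \<tau> \<longleftrightarrow> copies \<tau> \<pi> = {}"
  by (simp add: avoids_def flip: bij_betw_imp_surj_on[OF bij_betw_occurrences_copies[OF assms]])

lemma finite_copies: "finite (copies \<tau> xs)"
  by (rule finite_subset[of _ "set (subseqs xs)"]) (auto simp: copies_def)

lemma set_copies: "v \<in> copies \<tau> xs \<Longrightarrow> set v \<subseteq> set xs"
  by (simp add: copies_def set_subseq)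

lemma length_copies: "v \<in> copies \<tau> xs \<Longrightarrow> length v = length \<tau>"
  by (simp add: copies_def order_isomorphic_def)

lemma copies_disjoint:
  assumes "set xs \<inter> set ys = {}" "\<tau> \<noteq> []"
  shows "copies \<tau> xs \<inter> copies \<tau> ys = {}"
proof (rule equals0I)
  fix v assume v: "v \<in> copies \<tau> xs \<inter> copies \<tau> ys"
  then have "set v \<subseteq> set xs \<inter> set ys"
    using set_copies by blast
  moreover have "v \<noteq> []"
    using v length_copies assms(2) by fastforce
  ultimately show False
    using assms(1) by simp
qed

lemma copies_mono: "subseq xs ys \<Longrightarrow> copies \<tau> xs \<subseteq> copies \<tau> ys"
  unfolding copies_def by (blast intro: subseq_order.order_trans)

lemma copies_short: "length xs < length \<tau> \<Longrightarrow> copies \<tau> xs = {}"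
  by (auto simp: copies_def order_isomorphic_def)

lemma order_isomorphic_nth_less_iff:
  "order_isomorphic u v \<Longrightarrow> a < length v \<Longrightarrow> b < length v \<Longrightarrow> u ! a < u ! b \<longleftrightarrow> v ! a < v ! b"
  by (simp add: order_isomorphic_def)

lemma order_isomorphic_map:
  assumes "strict_mono_on (set v) f"
  shows "order_isomorphic (map f v) \<tau> \<longleftrightarrow> order_isomorphic v \<tau>"
  by (auto simp: order_isomorphic_def strict_mono_on_less[OF assms])

lemma copies_map:
  assumes "strict_mono_on (set xs) f"
  shows "copies \<tau> (map f xs) = map f ` copies \<tau> xs"
proof -
  have iso: "order_isomorphic (map f v) \<tau> \<longleftrightarrow> order_isomorphic v \<tau>" if "subseq v xs" for v
    using assms set_subseq[OF that] by (intro order_isomorphic_map) (rule monotone_on_subset)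
  show ?thesis
  proof (intro equalityI subsetI)
    fix w assume "w \<in> copies \<tau> (map f xs)"
    then obtain v where "subseq v xs" "w = map f v" "order_isomorphic w \<tau>"
      by (auto simp: copies_def elim: subseq_mapE)
    then show "w \<in> map f ` copies \<tau> xs"
      by (simp add: copies_def iso)
  qed (auto simp: copies_def iso subseq_map)
qed

lemma order_isomorphic_snoc_max:
  assumes "\<And>y. y \<in> set v \<Longrightarrow> y < x" "\<And>t. t \<in> set \<tau> \<Longrightarrow> t < m"
  shows "order_isomorphic (v @ [x]) (\<tau> @ [m]) \<longleftrightarrow> order_isomorphic v \<tau>"
proof (cases "length v = length \<tau>")
  case True
  have "v ! i < x" "\<not> x < v ! i" "\<tau> ! i < m" "\<not> m < \<tau> ! i" if "i < length \<tau>" for i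
    using that True assms[OF nth_mem] by (auto dest: order.asym)
  then show ?thesis
    using True by (auto simp: order_isomorphic_def nth_append less_Suc_eq)
qed (simp add: order_isomorphic_def)

definition all_above :: "nat list \<Rightarrow> nat list \<Rightarrow> bool" where
  "all_above xs ys \<longleftrightarrow> (\<forall>x\<in>set xs. \<forall>y\<in>set ys. y < x)"

lemma all_aboveD: "all_above xs ys \<Longrightarrow> x \<in> set xs \<Longrightarrow> y \<in> set ys \<Longrightarrow> y < x"
  by (simp add: all_above_def)

text \<open>A pattern whose first letter is below its last is not of the form \<open>\<sigma> @ \<rho>\<close> with \<open>\<sigma>\<close> above \<open>\<rho>\<close>.\<close>

lemma copies_append_all_above:
  assumes "all_above xs ys" "\<tau> \<noteq> []" "hd \<tau> < last \<tau>"
  shows "copies \<tau> (xs @ ys) = copies \<tau> xs \<union> copies \<tau> ys"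
proof -
  have not_across: "v1 = [] \<or> v2 = []"
    if v: "subseq v1 xs" "subseq v2 ys" "order_isomorphic (v1 @ v2) \<tau>" for v1 v2
  proof (rule ccontr)
    assume ne: "\<not> (v1 = [] \<or> v2 = [])"
    have "(v1 @ v2) ! 0 < (v1 @ v2) ! (length \<tau> - 1) \<longleftrightarrow> \<tau> ! 0 < \<tau> ! (length \<tau> - 1)"
      using assms(2) by (intro order_isomorphic_nth_less_iff[OF v(3)]) auto
    moreover have "length (v1 @ v2) = length \<tau>"
      using v(3) by (simp add: order_isomorphic_def)
    ultimately have "hd (v1 @ v2) < last (v1 @ v2)"
      using ne assms(2,3) by (metis append_is_Nil_conv hd_conv_nth last_conv_nth)
    moreover have "hd v1 \<in> set xs" "last v2 \<in> set ys"
      using ne set_subseq[OF v(1)] set_subseq[OF v(2)] by auto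
    ultimately show False
      using ne all_aboveD[OF assms(1), of "hd v1" "last v2"] by simp
  qed
  show ?thesis
  proof (intro equalityI subsetI)
    fix v assume "v \<in> copies \<tau> (xs @ ys)"
    then obtain v1 v2 where "v = v1 @ v2" "subseq v1 xs" "subseq v2 ys" "order_isomorphic v \<tau>"
      by (auto simp: copies_def elim: subseq_appendE)
    then show "v \<in> copies \<tau> xs \<union> copies \<tau> ys"
      using not_across[of v1 v2] by (auto simp: copies_def)
  qed (auto simp: copies_def intro: subseq_rev_drop_many subseq_drop_many)
qed

lemma subseq_snoc_iff: "subseq v (xs @ [x]) \<longleftrightarrow> subseq v xs \<or> (\<exists>u. v = u @ [x] \<and> subseq u xs)"
  unfolding subseq_append_Cons_iff by auto

lemma copies_snoc_max_eq:
  assumes "\<And>x. x \<in> set xs \<Longrightarrow> x < M" "t \<in> set \<tau>" "last \<tau> < t"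
  shows "copies \<tau> (xs @ [M]) = copies \<tau> xs"
proof -
  have "\<not> order_isomorphic (u @ [M]) \<tau>" if "subseq u xs" for u
  proof
    assume iso: "order_isomorphic (u @ [M]) \<tau>"
    obtain i where i: "i < length \<tau>" "\<tau> ! i = t"
      using assms(2) by (auto simp: in_set_conv_nth)
    have len: "length \<tau> = Suc (length u)"
      using iso by (simp add: order_isomorphic_def)
    then have "last \<tau> = \<tau> ! length u"
      by (subst last_conv_nth) auto
    moreover have "(u @ [M]) ! length u < (u @ [M]) ! i \<longleftrightarrow> \<tau> ! length u < \<tau> ! i"
      using i(1) len by (intro order_isomorphic_nth_less_iff[OF iso]) simp_all
    ultimately have "M < (u @ [M]) ! i"
      using i(2) assms(3) by simp
    moreover have "(u @ [M]) ! i \<in> insert M (set xs)"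
      using set_subseq[OF that] nth_mem[of i "u @ [M]"] i(1) len by auto
    ultimately show False
      using assms(1)[of "(u @ [M]) ! i"] by auto
  qed
  then show ?thesis
    unfolding copies_def subseq_snoc_iff by blast
qed

lemma copies_snoc_max_empty_iff:
  assumes "\<And>x. x \<in> set xs \<Longrightarrow> x < M" "\<And>t. t \<in> set \<tau> \<Longrightarrow> t < m"
  shows "copies (\<tau> @ [m]) (xs @ [M]) = {} \<longleftrightarrow> copies \<tau> xs = {}"
proof -
  have iso: "order_isomorphic (u @ [M]) (\<tau> @ [m]) \<longleftrightarrow> order_isomorphic u \<tau>" if "subseq u xs" for u
    using assms set_subseq[OF that] by (intro order_isomorphic_snoc_max) auto
  have "copies \<tau> xs \<noteq> {}" if v: "v \<in> copies (\<tau> @ [m]) xs" for v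
  proof -
    from v have "v \<noteq> []" "subseq v xs" "order_isomorphic v (\<tau> @ [m])"
      by (auto simp: copies_def order_isomorphic_def)
    then have "order_isomorphic (butlast v) \<tau>"
      by (auto simp: order_isomorphic_def nth_butlast nth_append)
    moreover have "subseq (butlast v) xs"
      using \<open>subseq v xs\<close> prefix_imp_subseq[OF prefixeq_butlast] subseq_order.order_trans by blast
    ultimately show ?thesis
      by (auto simp: copies_def)
  qed
  then show ?thesis
    using iso unfolding copies_def subseq_snoc_iff by blast
qed

lemma order_isomorphic_triple_iff:
  "order_isomorphic v [x, y, z] \<longleftrightarrow> (\<exists>a b c. v = [a, b, c] \<and>
     (a < b \<longleftrightarrow> x < y) \<and> (b < a \<longleftrightarrow> y < x) \<and> (a < c \<longleftrightarrow> x < z) \<and> (c < a \<longleftrightarrow> z < x) \<and>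
     (b < c \<longleftrightarrow> y < z) \<and> (c < b \<longleftrightarrow> z < y))"
proof (cases "\<exists>a b c. v = [a, b, c]")
  case True
  then obtain a b c where v: "v = [a, b, c]"
    by blast
  show ?thesis
    unfolding order_isomorphic_def v by (simp add: All_less_Suc conj_ac)
next
  case False
  then have "length v \<noteq> length [x, y, z]"
    by (auto simp: length_Suc_conv)
  with False show ?thesis
    unfolding order_isomorphic_def by blast
qed
lemma order_isomorphic_132_iff:
  "order_isomorphic v pattern_132 \<longleftrightarrow> (\<exists>a b c. v = [a, b, c] \<and> a < c \<and> c < b)"
  by (auto simp: pattern_132_def order_isomorphic_triple_iff)

lemma pattern_213k_2: "pattern_213k 2 = [2, 1]"
  and pattern_213k_3: "pattern_213k 3 = [2, 1, 3]"
  by (simp_all add: pattern_213k_def)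

lemma pattern_213k_Suc: "k \<ge> 2 \<Longrightarrow> pattern_213k (Suc k) = pattern_213k k @ [Suc k]"
  by (simp add: pattern_213k_def)

lemma length_pattern_213k: "k \<ge> 2 \<Longrightarrow> length (pattern_213k k) = k"
  by (simp add: pattern_213k_def del: upt_Suc)

lemma less_Suc_if_in_pattern_213k: "k \<ge> 2 \<Longrightarrow> t \<in> set (pattern_213k k) \<Longrightarrow> t < Suc k"
  by (auto simp: pattern_213k_def)

lemma order_isomorphic_213_iff:
  "order_isomorphic v (pattern_213k 3) \<longleftrightarrow> (\<exists>a b c. v = [a, b, c] \<and> b < a \<and> a < c)"
  by (auto simp: pattern_213k_3 order_isomorphic_triple_iff)

lemma order_isomorphic_213kE:
  assumes "order_isomorphic v (pattern_213k k)" "k \<ge> 2"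
  obtains a b w where "v = a # b # w" "b < a" "sorted_wrt (<) (a # w)" "length w = k - 2"
proof -
  have len: "length v = k"
    using assms by (simp add: order_isomorphic_def length_pattern_213k)
  with assms(2) obtain a b w where v: "v = a # b # w" "length w = k - 2"
    by (auto simp: Suc_le_length_iff numeral_2_eq_2)
  have pattern: "pattern_213k k ! 0 = 2" "pattern_213k k ! 1 = 1"
    "i < k - 2 \<Longrightarrow> pattern_213k k ! Suc (Suc i) = i + 3" for i
    by (simp_all add: pattern_213k_def del: upt_Suc)
  have less: "v ! i < v ! j" if "pattern_213k k ! i < pattern_213k k ! j" "i < k" "j < k" for i j
    using order_isomorphic_nth_less_iff[OF assms(1)] that assms(2) by (simp add: length_pattern_213k)
  have "b < a"
    using less[of 1 0] pattern assms(2) by (simp add: v)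
  moreover have "a < w ! i" if "i < k - 2" for i
    using less[of 0 "Suc (Suc i)"] pattern that by (simp add: v)
  moreover have "w ! i < w ! j" if "i < j" "j < k - 2" for i j
    using less[of "Suc (Suc i)" "Suc (Suc j)"] pattern that by (simp add: v)
  ultimately have "b < a" "\<forall>x\<in>set w. a < x" "sorted_wrt (<) w"
    using v(2) by (auto simp: sorted_wrt_iff_nth_less in_set_conv_nth)
  then show thesis
    using v by (intro that) auto
qed

unbundle fps_syntax

section \<open>Generating functions of classes of permutations\<close>

definition order_invariant :: "(nat list \<Rightarrow> bool) \<Rightarrow> bool" where
  "order_invariant P \<longleftrightarrow> (\<forall>f xs. strict_mono_on (set xs) f \<longrightarrow> P (map f xs) = P xs)"

definition num_perms :: "(nat list \<Rightarrow> bool) \<Rightarrow> nat \<Rightarrow> nat" where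
  "num_perms P n = card {xs \<in> permutations_of_set {1..n}. P xs}"

definition perm_gf :: "(nat list \<Rightarrow> bool) \<Rightarrow> 'a::comm_ring_1 fps" where
  "perm_gf P = Abs_fps (\<lambda>n. of_nat (num_perms P n))"

lemma perm_gf_nth: "perm_gf P $ n = of_nat (num_perms P n)"
  by (simp add: perm_gf_def)

lemma num_perms_0: "num_perms P 0 = (if P [] then 1 else 0)"
proof -
  have "{xs \<in> permutations_of_set {1..0}. P xs} = (if P [] then {[]} else {})"
    by auto
  then show ?thesis
    by (simp add: num_perms_def)
qed

lemma num_perms_cong:
  assumes "\<And>xs. xs \<in> permutations_of_set {1..n} \<Longrightarrow> P xs \<longleftrightarrow> Q xs"
  shows "num_perms P n = num_perms Q n"
  unfolding num_perms_def using assms by (metis (no_types, lifting) Collect_cong)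

lemma perm_gf_cong:
  assumes "\<And>xs. distinct xs \<Longrightarrow> P xs \<longleftrightarrow> Q xs"
  shows "perm_gf P = perm_gf Q"
  unfolding perm_gf_def
  by (intro arg_cong[where f = Abs_fps] ext arg_cong[where f = of_nat] num_perms_cong assms)
     (rule permutations_of_setD)

lemma perm_gf_disj:
  assumes "\<And>xs. distinct xs \<Longrightarrow> \<not> (P xs \<and> Q xs)"
  shows "perm_gf (\<lambda>xs. P xs \<or> Q xs) = perm_gf P + perm_gf Q"
proof -
  have "num_perms (\<lambda>xs. P xs \<or> Q xs) n = num_perms P n + num_perms Q n" for n
  proof -
    have "{xs \<in> permutations_of_set {1..n}. P xs} \<inter> {xs \<in> permutations_of_set {1..n}. Q xs} = {}"
      using assms permutations_of_setD(2) by blast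
    then show ?thesis
      by (simp add: num_perms_def card_Un_disjoint conj_disj_distribL Collect_disj_eq)
  qed
  then show ?thesis
    by (simp add: fps_eq_iff perm_gf_nth)
qed

lemma perm_gf_False: "perm_gf (\<lambda>_. False) = 0"
  by (simp add: fps_eq_iff perm_gf_nth num_perms_def)

lemma perm_gf_length_eq: "perm_gf (\<lambda>xs. length xs = m) = fps_const (of_nat (fact m)) * fps_X ^ m"
proof (rule fps_ext)
  fix n
  have "{xs \<in> permutations_of_set {1..n}. length xs = m} =
      (if n = m then permutations_of_set {1..n} else {})"
    by (auto simp: length_finite_permutations_of_set)
  then show "perm_gf (\<lambda>xs. length xs = m) $ n = (fps_const (of_nat (fact m)) * fps_X ^ m :: 'a fps) $ n"
    by (simp add: perm_gf_nth num_perms_def fps_X_power_iff)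
qed

lemma card_permutations_order_invariant:
  fixes S :: "nat set"
  assumes "order_invariant P" "finite S"
  shows "card {xs \<in> permutations_of_set S. P xs} = num_perms P (card S)"
proof -
  define f where "f i = sorted_list_of_set S ! (i - 1)" for i
  have mono: "strict_mono_on {1..card S} f"
    using assms(2)
    by (auto simp: f_def intro!: strict_mono_onI sorted_wrt_nth_less[OF strict_sorted_list_of_set])
  then have inj: "inj_on f {1..card S}"
    by (rule strict_mono_on_imp_inj_on)
  have "f ` {1..card S} = S"
  proof (rule card_subset_eq)
    show "f ` {1..card S} \<subseteq> S"
      using assms(2) nth_mem[of _ "sorted_list_of_set S"] by (fastforce simp: f_def)
  qed (use assms(2) inj in \<open>simp_all add: card_image\<close>)
  then have "permutations_of_set S = map f ` permutations_of_set {1..card S}"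
    using permutations_of_set_image_inj[OF inj] by simp
  moreover have "P (map f xs) \<longleftrightarrow> P xs" if "xs \<in> permutations_of_set {1..card S}" for xs
    using assms(1) mono permutations_of_setD(1)[OF that] by (simp add: order_invariant_def)
  ultimately have
    "{xs \<in> permutations_of_set S. P xs} = map f ` {xs \<in> permutations_of_set {1..card S}. P xs}"
    by auto
  moreover have "inj_on (map f) {xs \<in> permutations_of_set {1..card S}. P xs}"
  proof (rule inj_onI)
    fix u v
    assume "u \<in> {xs \<in> permutations_of_set {1..card S}. P xs}"
      "v \<in> {xs \<in> permutations_of_set {1..card S}. P xs}" "map f u = map f v"
    moreover from this have "set u \<union> set v = {1..card S}"
      by (auto dest: permutations_of_setD)
    ultimately show "u = v"
      using inj inj_on_map_eq_map[of f u v] by metis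
  qed
  ultimately show ?thesis
    by (simp add: num_perms_def card_image)
qed

lemma order_invariant_conj:
  "order_invariant P \<Longrightarrow> order_invariant Q \<Longrightarrow> order_invariant (\<lambda>xs. P xs \<and> Q xs)"
  by (simp add: order_invariant_def)

lemma order_invariant_length: "order_invariant (\<lambda>xs. P (length xs))"
  by (simp add: order_invariant_def)

lemma order_invariant_card_copies: "order_invariant (\<lambda>xs. P (card (copies \<tau> xs)))"
  unfolding order_invariant_def
proof (intro allI impI)
  fix f :: "nat \<Rightarrow> nat" and xs assume f: "strict_mono_on (set xs) f"
  have "inj_on (map f) (copies \<tau> xs)"
  proof (rule inj_onI)
    fix u v assume "u \<in> copies \<tau> xs" "v \<in> copies \<tau> xs" "map f u = map f v"
    moreover from this have "inj_on f (set u \<union> set v)"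
      using strict_mono_on_imp_inj_on[OF f] set_copies by (metis Un_least inj_on_subset)
    ultimately show "u = v"
      by (simp add: inj_on_map_eq_map)
  qed
  then show "P (card (copies \<tau> (map f xs))) = P (card (copies \<tau> xs))"
    by (simp add: copies_map[OF f] card_image)
qed

section \<open>Words split at their maximum\<close>

definition peak :: "nat list \<Rightarrow> nat \<Rightarrow> nat list \<Rightarrow> bool" where
  "peak L M R \<longleftrightarrow> (\<forall>x\<in>set L \<union> set R. x < M)"

lemma peakD: "peak L M R \<Longrightarrow> x \<in> set L \<union> set R \<Longrightarrow> x < M"
  by (simp add: peak_def)

lemma peakE:
  assumes "distinct xs" "xs \<noteq> []"
  obtains L M R where "xs = L @ M # R" "peak L M R"
proof -
  define M where "M = Max (set xs)"
  have "M \<in> set xs"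
    using assms(2) by (simp add: M_def)
  then obtain L R where xs: "xs = L @ M # R"
    by (auto simp: in_set_conv_decomp)
  have "x < M" if "x \<in> set L \<union> set R" for x
  proof -
    have "x \<in> set xs" "x \<noteq> M"
      using that assms(1) xs by auto
    then show ?thesis
      by (simp add: M_def le_neq_implies_less)
  qed
  with xs show thesis
    by (intro that) (auto simp: peak_def)
qed

lemma peak_unique:
  assumes "peak L M R" "peak L' M' R'" "L @ M # R = L' @ M' # R'"
  shows "L = L'" "M = M'" "R = R'"
proof -
  have "M' \<in> insert M (set L \<union> set R)" "M \<in> insert M' (set L' \<union> set R')"
    using arg_cong[OF assms(3), of set] by auto
  then show "M = M'"
    using peakD[OF assms(1), of M'] peakD[OF assms(2), of M] by fastforce
  moreover have "M \<notin> set L" "M \<notin> set R"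
    using peakD[OF assms(1), of M] by auto
  ultimately show "L = L'" "R = R'"
    using append_Cons_eq_iff[of M L R L' R'] assms(3) by auto
qed

lemma peak_permutation_eq:
  assumes "peak L M R" "L @ M # R \<in> permutations_of_set {1..n}"
  shows "M = n"
proof -
  have letters: "insert M (set L \<union> set R) = {1..n}"
    using permutations_of_setD(1)[OF assms(2)] by simp
  then have "M \<in> {1..n}"
    by blast
  then have "n \<in> insert M (set L \<union> set R)" "M \<le> n"
    by (simp_all add: letters)
  then show ?thesis
    using peakD[OF assms(1), of n] by auto
qed

definition split_product :: "(nat list \<Rightarrow> bool) \<Rightarrow> (nat list \<Rightarrow> bool) \<Rightarrow> nat list \<Rightarrow> bool" where
  "split_product P Q xs \<longleftrightarrow> (\<exists>L M R. xs = L @ M # R \<and> peak L M R \<and> all_above L R \<and> P L \<and> Q R)"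

lemma initial_segment_eq:
  fixes A :: "nat set"
  assumes "A \<subseteq> {1..n}" "\<And>a b. a \<in> A \<Longrightarrow> b \<in> {1..n} - A \<Longrightarrow> a < b"
  shows "A = {1..card A}"
proof (cases "A = {}")
  case False
  have fin: "finite A"
    using assms(1) finite_subset by blast
  then have "Max A \<in> A"
    using False by simp
  have "A = {1..Max A}"
  proof (intro equalityI subsetI)
    fix b assume b: "b \<in> {1..Max A}"
    then have "b \<in> {1..n}"
      using \<open>Max A \<in> A\<close> assms(1) by fastforce
    with b show "b \<in> A"
      using assms(2)[OF \<open>Max A \<in> A\<close>, of b] by fastforce
  qed (use fin assms(1) in auto)
  then show ?thesis
    by (metis card_atLeastAtMost diff_Suc_1)
qed simp

text \<open>
  The length \<open>m\<close> of \<open>R\<close> determines the letters of \<open>L\<close>, those of \<open>R\<close>, and the letters between \<open>L\<close> and \<open>n\<close>.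
\<close>

lemma card_words_by_right_length:
  fixes A B :: "nat \<Rightarrow> nat set" and mid :: "nat \<Rightarrow> nat list"
  assumes "order_invariant P" "order_invariant Q" "finite I"
    and A: "\<And>m. m \<in> I \<Longrightarrow> finite (A m) \<and> n \<notin> A m \<union> set (mid m)"
    and B: "\<And>m. m \<in> I \<Longrightarrow> finite (B m) \<and> n \<notin> B m \<and> card (B m) = m"
  shows "card {(L @ mid m) @ n # R | m L R. m \<in> I \<and> L \<in> permutations_of_set (A m) \<and> P L \<and>
            R \<in> permutations_of_set (B m) \<and> Q R} =
         (\<Sum>m\<in>I. num_perms P (card (A m)) * num_perms Q m)" (is "card ?W = _")
proof -
  define X where "X m = {L \<in> permutations_of_set (A m). P L}" for m
  define Y where "Y m = {R \<in> permutations_of_set (B m). Q R}" for m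
  define g where "g = (\<lambda>(m, L, R). (L @ mid m) @ n # R)"
  have "inj_on g (SIGMA m:I. X m \<times> Y m)"
  proof (rule inj_onI)
    fix s t
    assume "s \<in> (SIGMA m:I. X m \<times> Y m)" "t \<in> (SIGMA m:I. X m \<times> Y m)" "g s = g t"
    then obtain m L R m' L' R' where st: "s = (m, L, R)" "t = (m', L', R')"
      and m: "m \<in> I" "m' \<in> I" and LL': "L \<in> X m" "L' \<in> X m'" and RR': "R \<in> Y m" "R' \<in> Y m'"
      and "(L @ mid m) @ n # R = (L' @ mid m') @ n # R'"
      by (auto simp: g_def)
    moreover have "n \<notin> set (L @ mid m)" "n \<notin> set R"
      using A[OF m(1)] B[OF m(1)] LL'(1) RR'(1) by (auto simp: X_def Y_def permutations_of_set_def)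
    ultimately have words_eq: "L @ mid m = L' @ mid m'" "R = R'"
      by (simp_all add: append_Cons_eq_iff del: append_assoc)
    have "m = length R" "m' = length R'"
      using B[OF m(1)] B[OF m(2)] RR' by (auto simp: Y_def length_finite_permutations_of_set)
    with words_eq show "s = t"
      by (simp add: st)
  qed
  moreover have "?W = g ` (SIGMA m:I. X m \<times> Y m)"
    by (force simp: g_def X_def Y_def)
  ultimately have "card ?W = (\<Sum>m\<in>I. card (X m) * card (Y m))"
    using assms(3) by (simp add: card_image card_cartesian_product X_def Y_def)
  also have "\<dots> = (\<Sum>m\<in>I. num_perms P (card (A m)) * num_perms Q m)"
    using A B card_permutations_order_invariant[OF assms(1)] card_permutations_order_invariant[OF assms(2)]
    by (intro sum.cong) (simp_all add: X_def Y_def)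
  finally show ?thesis .
qed

lemma split_product_letters:
  assumes "peak L M R" "all_above L R" "L @ M # R \<in> permutations_of_set {1..n}"
  shows "set R = {1..length R}" "set L = {Suc (length R)..<n}" "length R < n"
proof -
  have M: "M = n"
    using assms(1,3) by (rule peak_permutation_eq)
  have perm: "set L \<union> insert n (set R) = {1..n}" "distinct (L @ n # R)"
    using permutations_of_setD[OF assms(3)] by (simp_all add: M)
  have "set R = {1..card (set R)}"
  proof (rule initial_segment_eq)
    fix a b assume "a \<in> set R" "b \<in> {1..n} - set R"
    moreover from this have "b = n \<or> b \<in> set L"
      using perm(1) by blast
    ultimately show "a < b"
      using peakD[OF assms(1), of a] all_aboveD[OF assms(2), of b a] M by auto
  qed (use perm in auto)
  then show R: "set R = {1..length R}"
    using perm(2) by (simp add: distinct_card)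
  have "set L = {1..n} - insert n (set R)"
    using perm by auto
  also have "\<dots> = {Suc (length R)..<n}"
    by (subst R) auto
  finally show "set L = {Suc (length R)..<n}" .
  show "length R < n"
    using length_finite_permutations_of_set[OF assms(3)] by simp
qed

lemma split_product_permutations:
  "{xs \<in> permutations_of_set {1..n}. split_product P Q xs} =
   {(L @ []) @ n # R | m L R. m \<in> {..<n} \<and> L \<in> permutations_of_set {Suc m..<n} \<and> P L \<and>
      R \<in> permutations_of_set {1..m} \<and> Q R}" (is "?S = ?W")
proof (intro equalityI subsetI)
  fix xs assume "xs \<in> ?S"
  then obtain L M R where xs: "xs = L @ M # R" "peak L M R" "all_above L R" "P L" "Q R"
      "L @ M # R \<in> permutations_of_set {1..n}"
    by (auto simp: split_product_def)
  have "L \<in> permutations_of_set {Suc (length R)..<n}" "R \<in> permutations_of_set {1..length R}"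
    using split_product_letters[OF xs(2,3,6)] permutations_of_setD(2)[OF xs(6)]
    by (auto intro: permutations_of_setI)
  moreover have "length R \<in> {..<n}" "xs = L @ n # R"
    using split_product_letters(3)[OF xs(2,3,6)] peak_permutation_eq[OF xs(2,6)] xs(1) by auto
  ultimately show "xs \<in> ?W"
    unfolding append_Nil2 using xs(4,5) by blast
next
  fix xs assume "xs \<in> ?W"
  then obtain m L R where xs: "xs = L @ n # R" "m < n" "P L" "Q R"
      and "L \<in> permutations_of_set {Suc m..<n}" "R \<in> permutations_of_set {1..m}"
    by auto
  then have LR: "set L = {Suc m..<n}" "distinct L" "set R = {1..m}" "distinct R"
    by (auto dest: permutations_of_setD)
  then have "xs \<in> permutations_of_set {1..n}"
    using xs(1,2) by (intro permutations_of_setI) auto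
  moreover have "peak L n R" "all_above L R"
    using LR xs(2) by (auto simp: peak_def all_above_def)
  ultimately show "xs \<in> ?S"
    using xs by (auto simp: split_product_def)
qed

lemma fps_X_mult_mult_nth:
  fixes f g :: "'a::comm_semiring_1 fps"
  shows "(fps_X * f * g) $ n = (\<Sum>m<n. f $ (n - 1 - m) * g $ m)"
proof (cases n)
  case (Suc k)
  have "(fps_X * f * g) $ n = (f * g) $ k"
    by (simp add: Suc mult.assoc)
  also have "\<dots> = (g * f) $ k"
    by (simp only: mult.commute)
  also have "\<dots> = (\<Sum>m<n. f $ (n - 1 - m) * g $ m)"
    unfolding fps_mult_nth by (simp add: Suc atLeast0AtMost lessThan_Suc_atMost mult.commute)
  finally show ?thesis .
qed (simp add: mult.assoc)

lemma perm_gf_split_product: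
  assumes "order_invariant P" "order_invariant Q"
  shows "perm_gf (split_product P Q) = fps_X * perm_gf P * perm_gf Q"
proof (rule fps_ext)
  fix n
  have "num_perms (split_product P Q) n = (\<Sum>m<n. num_perms P (n - 1 - m) * num_perms Q m)"
    unfolding num_perms_def[of "split_product P Q"] split_product_permutations
    by (subst card_words_by_right_length[OF assms]) auto
  then show "perm_gf (split_product P Q) $ n = (fps_X * perm_gf P * perm_gf Q :: 'a fps) $ n"
    by (simp add: perm_gf_nth fps_X_mult_mult_nth)
qed

section \<open>Crossing words\<close>

text \<open>The shape of a permutation whose only copy \<open>l M r\<close> of \<open>1-3-2\<close> uses its maximum \<open>M\<close>.\<close>

locale crossing =
  fixes L :: "nat list" and l M r :: nat and R :: "nat list"
  assumes peak_snoc: "peak (L @ [l]) M R"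
    and r_in_right: "r \<in> set R"
    and l_less_r: "l < r"
    and r_less_left: "x \<in> set L \<Longrightarrow> r < x"
    and right_less_l: "y \<in> set R \<Longrightarrow> y \<noteq> r \<Longrightarrow> y < l"
begin

lemma peak: "peak L M R"
  and l_less_M: "l < M"
  using peak_snoc by (auto simp: peak_def)

lemma right_le_r: "y \<in> set R \<Longrightarrow> y \<le> r"
  using right_less_l[of y] l_less_r by fastforce

lemma l_not_in_right: "l \<notin> set R"
  using right_less_l[of l] l_less_r by auto

lemma eq_r_if_l_less: "y \<in> set R \<Longrightarrow> l < y \<Longrightarrow> y = r"
  using right_less_l[of y] by fastforce

lemma left_all_above: "all_above L (l # R)"
  using r_less_left right_le_r l_less_r by (fastforce simp: all_above_def)

lemma not_all_above_snoc: "\<not> all_above (L @ [l]) R"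
  using all_aboveD[of "L @ [l]" R l r] r_in_right l_less_r by auto

lemma right_nonempty: "1 \<le> length R"
  using r_in_right by (cases R) auto

context
  fixes n
  assumes permutation: "L @ l # M # R \<in> permutations_of_set {1..n}"
begin

lemma M_eq: "M = n"
  using peak_permutation_eq[OF peak_snoc] permutation by simp

lemma letters: "set L \<union> insert l (insert n (set R)) = {1..n}"
  and distinct: "distinct (L @ l # n # R)"
  using permutations_of_setD[OF permutation] by (simp_all add: M_eq)

lemma insert_l_right_eq: "insert l (set R) = {1..Suc (length R)}"
proof -
  have "insert l (set R) = {1..card (insert l (set R))}"
  proof (rule initial_segment_eq)
    fix a b assume a: "a \<in> insert l (set R)" and "b \<in> {1..n} - insert l (set R)"
    then have "b \<in> insert n (set L)"
      using letters by blast
    moreover have "a \<le> r"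
      using a right_le_r l_less_r by auto
    moreover have "a < n"
      using a peakD[OF peak, of a] l_less_M M_eq by auto
    ultimately show "a < b"
      using r_less_left[of b] by auto
  qed (use letters in auto)
  then show ?thesis
    using distinct by (simp add: distinct_card)
qed

lemma r_eq: "r = Suc (length R)"
proof -
  have "r \<in> {1..Suc (length R)}"
    using r_in_right insert_l_right_eq by blast
  moreover have "Suc (length R) \<in> insert l (set R)"
    by (simp add: insert_l_right_eq)
  ultimately show ?thesis
    using l_less_r right_le_r[of "Suc (length R)"] by auto
qed

lemma l_eq: "l = length R"
proof (rule ccontr)
  assume "l \<noteq> length R"
  moreover have "length R \<in> insert l (set R)"
    using right_nonempty by (simp add: insert_l_right_eq)
  ultimately show False
    using right_less_l[of "length R"] l_less_r r_eq by auto
qed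

lemma set_right_eq: "set R = {1..Suc (length R)} - {length R}"
proof -
  have "set R = insert l (set R) - {l}"
    using l_not_in_right by auto
  then show ?thesis
    by (simp only: insert_l_right_eq flip: l_eq)
qed

lemma set_left_eq: "set L = {Suc (Suc (length R))..<n}"
proof -
  have "set L = {1..n} - insert n (insert l (set R))"
    using letters distinct by auto
  also have "\<dots> = {Suc (Suc (length R))..<n}"
    unfolding insert_l_right_eq by auto
  finally show ?thesis .
qed

lemma Suc_length_right_less: "Suc (length R) < n"
  using peakD[OF peak, of r] r_in_right by (simp add: r_eq M_eq)

end

end

definition crossing_product :: "(nat list \<Rightarrow> bool) \<Rightarrow> (nat list \<Rightarrow> bool) \<Rightarrow> nat list \<Rightarrow> bool" where
  "crossing_product P Q xs \<longleftrightarrow> (\<exists>L l M r R. xs = L @ l # M # R \<and> crossing L l M r R \<and> P L \<and> Q R)"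

lemma crossing_product_permutations:
  "{xs \<in> permutations_of_set {1..n}. crossing_product P Q xs} =
   {(L @ [m]) @ n # R | m L R. m \<in> {1..<n - 1} \<and> L \<in> permutations_of_set {Suc (Suc m)..<n} \<and> P L \<and>
      R \<in> permutations_of_set ({1..Suc m} - {m}) \<and> Q R}" (is "?S = ?W")
proof (intro equalityI subsetI)
  fix xs assume "xs \<in> ?S"
  then obtain L l M r R where xs: "xs = L @ l # M # R" and "crossing L l M r R" and PQ: "P L" "Q R"
      and perm: "L @ l # M # R \<in> permutations_of_set {1..n}"
    by (auto simp: crossing_product_def)
  then interpret crossing L l M r R
    by simp
  have "L \<in> permutations_of_set {Suc (Suc (length R))..<n}"
      "R \<in> permutations_of_set ({1..Suc (length R)} - {length R})"
    using set_left_eq[OF perm] set_right_eq[OF perm] permutations_of_setD(2)[OF perm]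
    by (auto intro: permutations_of_setI)
  moreover have "length R \<in> {1..<n - 1}"
    using right_nonempty Suc_length_right_less[OF perm] by simp
  moreover have "xs = (L @ [length R]) @ n # R"
    using xs M_eq[OF perm] l_eq[OF perm] by simp
  ultimately show "xs \<in> ?W"
    using PQ by blast
next
  fix xs assume "xs \<in> ?W"
  then obtain m L R where xs: "xs = L @ m # n # R" "1 \<le> m" "Suc m < n" "P L" "Q R"
      and "L \<in> permutations_of_set {Suc (Suc m)..<n}" "R \<in> permutations_of_set ({1..Suc m} - {m})"
    by auto
  then have LR: "set L = {Suc (Suc m)..<n}" "distinct L" "set R = {1..Suc m} - {m}" "distinct R"
    by (auto dest: permutations_of_setD)
  then have "xs \<in> permutations_of_set {1..n}"
    using xs(1-3) by (intro permutations_of_setI) auto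
  moreover have "crossing L m n (Suc m) R"
    using LR xs(2,3) by (auto simp: crossing_def peak_def)
  ultimately show "xs \<in> ?S"
    using xs unfolding crossing_product_def by blast
qed

lemma perm_gf_crossing_product:
  assumes "order_invariant P" "order_invariant Q"
  shows "perm_gf (crossing_product P Q) =
    fps_X\<^sup>2 * perm_gf P * (perm_gf Q - (if Q [] then 1 else 0))"
proof (rule fps_ext)
  fix n
  define g :: "'a fps" where "g = perm_gf Q - (if Q [] then 1 else 0)"
  have g_nth: "g $ m = (if m = 0 then 0 else perm_gf Q $ m)" for m
    by (simp add: g_def perm_gf_nth num_perms_0)
  have "num_perms (crossing_product P Q) n = (\<Sum>m\<in>{1..<n - 1}. num_perms P (n - 2 - m) * num_perms Q m)"
    unfolding num_perms_def[of "crossing_product P Q"] crossing_product_permutations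
    by (subst card_words_by_right_length[OF assms]) auto
  then have "perm_gf (crossing_product P Q) $ n =
      (\<Sum>m\<in>{1..<n - 1}. perm_gf P $ (n - 2 - m) * perm_gf Q $ m)"
    by (simp add: perm_gf_nth)
  also have "\<dots> = (\<Sum>m<n. (fps_X * perm_gf P) $ (n - 1 - m) * g $ m)"
    by (rule sum.mono_neutral_cong_left) (auto simp: g_nth numeral_2_eq_2 less_diff_conv)
  also have "\<dots> = (fps_X * (fps_X * perm_gf P) * g) $ n"
    by (rule fps_X_mult_mult_nth[symmetric])
  finally show "perm_gf (crossing_product P Q) $ n =
      (fps_X\<^sup>2 * perm_gf P * (perm_gf Q - (if Q [] then 1 else 0)) :: 'a fps) $ n"
    by (simp add: g_def power2_eq_square mult.assoc)
qed

section \<open>Alternating words\<close>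

lemma alternating_up_Nil: "alternating_up []"
  and alternating_up_single: "alternating_up [x]"
  by (simp_all add: alternating_up_def)

lemma alternating_up_Cons_Cons:
  "alternating_up (x # y # zs) \<longleftrightarrow> x < y \<and> (zs \<noteq> [] \<longrightarrow> hd zs < y) \<and> alternating_up zs"
proof -
  have shift: "(\<forall>i. P i) \<longleftrightarrow> P 0 \<and> P 1 \<and> (\<forall>i. P (Suc (Suc i)))" for P :: "nat \<Rightarrow> bool"
    by (metis One_nat_def not0_implies_Suc)
  show ?thesis
    unfolding alternating_up_def by (subst shift) (auto simp: hd_conv_nth)
qed

lemma alternating_up_append:
  assumes "even (length xs)"
  shows "alternating_up (xs @ ys) \<longleftrightarrow>
    alternating_up xs \<and> alternating_up ys \<and> (xs \<noteq> [] \<longrightarrow> ys \<noteq> [] \<longrightarrow> hd ys < last xs)"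
  using assms
proof (induction xs rule: induct_list012)
  case (3 x y zs)
  then show ?case
    by (cases "zs = []") (auto simp: alternating_up_Cons_Cons alternating_up_Nil)
qed (simp_all add: alternating_up_Nil)

lemma alternating_up_snoc_max:
  assumes "\<And>x. x \<in> set L \<Longrightarrow> x < M" "odd (length L)"
  shows "alternating_up (L @ [M]) \<longleftrightarrow> alternating_up L"
proof -
  obtain L' a where L: "L = L' @ [a]" "even (length L')" "a < M"
    using assms by (cases L rule: rev_cases) auto
  then show ?thesis
    by (simp add: alternating_up_append alternating_up_Cons_Cons alternating_up_Nil alternating_up_single)
qed

lemma alternating_up_snoc_min:
  assumes "\<And>x. x \<in> set L \<Longrightarrow> m < x" "even (length L)"
  shows "alternating_up (L @ [m]) \<longleftrightarrow> alternating_up L"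
  using assms by (auto simp: alternating_up_append alternating_up_single)

lemma alternating_up_peak_iff:
  assumes "peak L M R" "L \<noteq> [] \<or> R \<noteq> []"
  shows "alternating_up (L @ M # R) \<longleftrightarrow> odd (length L) \<and> alternating_up L \<and> alternating_up R"
proof (cases "even (length L)")
  case True
  have "\<not> alternating_up (M # R)" if "R \<noteq> []"
    using that peakD[OF assms(1), of "hd R"] by (cases R) (auto simp: alternating_up_Cons_Cons)
  moreover have "\<not> M < last L" if "L \<noteq> []"
    using that peakD[OF assms(1), of "last L"] by simp
  ultimately show ?thesis
    using True assms(2) by (auto simp: alternating_up_append)
next
  case False
  have "alternating_up ((L @ [M]) @ R) \<longleftrightarrow> alternating_up (L @ [M]) \<and> alternating_up R"
    using False peakD[OF assms(1)] by (subst alternating_up_append) auto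
  then show ?thesis
    using alternating_up_snoc_max[of L M] False peakD[OF assms(1)] by simp
qed

lemma order_invariant_alternating_up: "order_invariant alternating_up"
  unfolding order_invariant_def
proof (intro allI impI)
  fix f :: "nat \<Rightarrow> nat" and xs assume "strict_mono_on (set xs) f"
  then have "f (xs ! i) < f (xs ! j) \<longleftrightarrow> xs ! i < xs ! j" if "i < length xs" "j < length xs" for i j
    using that by (simp add: strict_mono_on_less)
  then show "alternating_up (map f xs) = alternating_up xs"
    by (auto simp: alternating_up_def Suc_lessD)
qed

section \<open>Copies in words split at their maximum\<close>

lemma all_above_snoc_peak: "peak L M R \<Longrightarrow> all_above L R \<Longrightarrow> all_above (L @ [M]) R"
  by (auto simp: all_above_def peak_def)

lemma copies_split_eq:
  assumes "peak L M R" "all_above L R" "hd \<tau> < last \<tau>" "t \<in> set \<tau>" "last \<tau> < t"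
  shows "copies \<tau> (L @ M # R) = copies \<tau> L \<union> copies \<tau> R"
proof -
  have "copies \<tau> ((L @ [M]) @ R) = copies \<tau> (L @ [M]) \<union> copies \<tau> R"
    using assms by (intro copies_append_all_above all_above_snoc_peak) auto
  also have "copies \<tau> (L @ [M]) = copies \<tau> L"
    using peakD[OF assms(1)] assms(4,5) by (intro copies_snoc_max_eq) auto
  finally show ?thesis by simp
qed

lemma copies_split_snoc_max_empty_iff:
  assumes "peak L M R" "all_above L R" "\<tau> \<noteq> []" "\<And>t. t \<in> set \<tau> \<Longrightarrow> t < m"
  shows "copies (\<tau> @ [m]) (L @ M # R) = {} \<longleftrightarrow> copies \<tau> L = {} \<and> copies (\<tau> @ [m]) R = {}"
proof -
  have "copies (\<tau> @ [m]) ((L @ [M]) @ R) = copies (\<tau> @ [m]) (L @ [M]) \<union> copies (\<tau> @ [m]) R"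
    using assms by (intro copies_append_all_above all_above_snoc_peak) auto
  moreover have "copies (\<tau> @ [m]) (L @ [M]) = {} \<longleftrightarrow> copies \<tau> L = {}"
    using peakD[OF assms(1)] assms(4) by (intro copies_snoc_max_empty_iff) auto
  ultimately show ?thesis by simp
qed

lemma copies_132_split:
  assumes "peak L M R" "all_above L R"
  shows "copies pattern_132 (L @ M # R) = copies pattern_132 L \<union> copies pattern_132 R"
  using assms by (rule copies_split_eq[where t = 3]) (simp_all add: pattern_132_def)

lemma copies_213k_split_empty_iff:
  assumes "peak L M R" "all_above L R" "k \<ge> 2"
  shows "copies (pattern_213k (Suc k)) (L @ M # R) = {} \<longleftrightarrow>
    copies (pattern_213k k) L = {} \<and> copies (pattern_213k (Suc k)) R = {}"
  unfolding pattern_213k_Suc[OF assms(3)] using assms less_Suc_if_in_pattern_213k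
  by (intro copies_split_snoc_max_empty_iff) (auto simp: pattern_213k_def)

lemma peak_copy_132:
  assumes "peak L M R" "l \<in> set L" "r \<in> set R" "l < r"
  shows "[l, M, r] \<in> copies pattern_132 (L @ M # R)"
proof -
  have "subseq ([l] @ [M, r]) (L @ M # R)"
    using assms(2,3) by (intro list_emb_append_mono) (simp_all add: subseq_singleton_left)
  then show ?thesis
    using assms by (auto simp: copies_def order_isomorphic_132_iff peak_def)
qed

lemma copy_132_of_two_left_letters:
  assumes "subseq [l, x] L" "r \<in> set R" "l < r" "r < x"
  shows "[l, x, r] \<in> copies pattern_132 (L @ M # R)"
proof -
  have "subseq ([l, x] @ [r]) (L @ M # R)"
    using assms(1,2) by (intro list_emb_append_mono) (simp_all add: subseq_singleton_left)
  then show ?thesis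
    using assms(3,4) by (auto simp: copies_def order_isomorphic_132_iff)
qed

lemma not_all_aboveE:
  assumes "\<not> all_above L R" "set L \<inter> set R = {}"
  obtains l r where "l \<in> set L" "r \<in> set R" "l < r"
  using assms by (fastforce simp: all_above_def not_less order.order_iff_strict)

text \<open>
  Any \<open>l\<close> in \<open>L\<close> and \<open>r\<close> in \<open>R\<close> with \<open>l < r\<close> form a copy with \<open>M\<close>; a letter of \<open>L\<close> after \<open>l\<close> would form
  another.
\<close>

lemma single_copy_132_crossingE:
  assumes "distinct (L @ M # R)" "peak L M R" "card (copies pattern_132 (L @ M # R)) = 1"
    "\<not> all_above L R"
  obtains L' l r where "L = L' @ [l]" "crossing L' l M r R"
proof -
  have disjoint: "set L \<inter> set R = {}"
    using assms(1) by auto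
  with assms(4) obtain l r where lr: "l \<in> set L" "r \<in> set R" "l < r"
    by (rule not_all_aboveE)
  then have copies: "copies pattern_132 (L @ M # R) = {[l, M, r]}"
    using peak_copy_132[OF assms(2)] assms(3) by (metis card_1_singletonE singletonD)
  have uniq: "l' = l \<and> r' = r" if "l' \<in> set L" "r' \<in> set R" "l' < r'" for l' r'
    using peak_copy_132[OF assms(2) that] copies by simp
  obtain L1 L2 where L: "L = L1 @ l # L2"
    using lr(1) by (auto simp: in_set_conv_decomp)
  have above: "r < x" if "x \<in> set L1 \<union> set L2" for x
  proof -
    have "x \<in> set L" "x \<noteq> l" "x \<noteq> r"
      using that assms(1) L lr(2) by auto
    then show ?thesis
      using uniq[of x r] lr(2) by fastforce
  qed
  have "L2 = []"
  proof (rule ccontr)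
    assume "L2 \<noteq> []"
    then obtain x where x: "x \<in> set L2"
      using hd_in_set by blast
    then have "subseq [l, x] L"
      by (auto simp: L subseq_singleton_left intro: subseq_drop_many)
    then have "[l, x, r] \<in> copies pattern_132 (L @ M # R)"
      using lr(2,3) above[of x] x by (intro copy_132_of_two_left_letters) auto
    then show False
      using copies peakD[OF assms(2), of x] x L by auto
  qed
  moreover have "y < l" if "y \<in> set R" "y \<noteq> r" for y
    using uniq[of l y] that lr(1) disjoint by (metis disjoint_iff linorder_neqE_nat)
  ultimately show thesis
    using that[of L1 l r] L lr assms(2) above by (auto simp: crossing_def peak_def)
qed

section \<open>Copies in crossing words\<close>

context crossing
begin

lemma left_above_right: "all_above L R"
  using left_all_above by (simp add: all_above_def)

lemma copy_132_through_l_eq: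
  assumes "subseq v1 L" "subseq v2 (M # R)" "order_isomorphic (v1 @ l # v2) pattern_132"
  shows "v1 @ l # v2 = [l, M, r]"
proof -
  obtain a b c where abc: "v1 @ l # v2 = [a, b, c]" "a < c" "c < b"
    using assms(3) by (auto simp: order_isomorphic_132_iff)
  have "v1 = []"
  proof (rule ccontr)
    assume "v1 \<noteq> []"
    then have "a \<in> set v1" "l = b \<or> l = c"
      using abc(1) by (auto simp: Cons_eq_append_conv append_eq_Cons_conv)
    moreover from this have "l < a"
      using set_subseq[OF assms(1)] all_aboveD[OF left_all_above] by auto
    ultimately show False
      using abc(2,3) by auto
  qed
  then have "a = l" and bc: "subseq [b, c] (M # R)"
    using abc(1) assms(2) by auto
  have "c \<in> set R" "b \<in> insert M (set R)"
    using bc by (auto simp: subseq_singleton_left split: if_splits dest: set_subseq)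
  then have "c = r" "b = M"
    using right_le_r eq_r_if_l_less abc(2,3) \<open>a = l\<close> by force+
  then show ?thesis
    using abc(1) \<open>a = l\<close> by simp
qed

lemma copies_132_eq:
  "copies pattern_132 (L @ l # M # R) = insert [l, M, r] (copies pattern_132 L \<union> copies pattern_132 R)"
proof -
  have "[l, M, r] \<in> copies pattern_132 (L @ l # M # R)"
    using peak_copy_132[OF peak_snoc] r_in_right l_less_r by simp
  moreover have "copies pattern_132 (L @ M # R) \<subseteq> copies pattern_132 (L @ l # M # R)"
    by (intro copies_mono) (simp add: subseq_append' list_emb_Cons)
  moreover have "copies pattern_132 (L @ l # M # R) \<subseteq> insert [l, M, r] (copies pattern_132 (L @ M # R))"
    using copy_132_through_l_eq unfolding copies_def subseq_append_Cons_iff[of _ L l] by blast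
  moreover have "copies pattern_132 (L @ M # R) = copies pattern_132 L \<union> copies pattern_132 R"
    using peak left_above_right by (rule copies_132_split)
  ultimately show ?thesis
    by blast
qed

lemma card_copies_132_eq_1_iff:
  "card (copies pattern_132 (L @ l # M # R)) = 1 \<longleftrightarrow> copies pattern_132 L = {} \<and> copies pattern_132 R = {}"
proof -
  have "[l, M, r] \<notin> copies pattern_132 L \<union> copies pattern_132 R"
    using set_copies[of "[l, M, r]"] l_not_in_right peakD[OF peak, of M] by auto
  then show ?thesis
    by (simp add: copies_132_eq card_insert_if finite_copies)
qed

text \<open>
  For \<open>k \<ge> 4\<close> the pattern \<open>2-1-3-\<dots>-k\<close> has two increasing letters above its first two. To the right of
  \<open>l\<close>, however, only \<open>M\<close> exceeds a letter of \<open>L\<close>, and only \<open>r\<close> exceeds \<open>l\<close> after a smaller letter.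
\<close>

lemma no_copy_213k_through_l:
  assumes "subseq v1 L" "subseq v2 (M # R)" "k \<ge> 4"
  shows "\<not> order_isomorphic (v1 @ l # v2) (pattern_213k k)"
proof
  assume "order_isomorphic (v1 @ l # v2) (pattern_213k k)"
  then obtain a b w where abw: "v1 @ l # v2 = a # b # w" "b < a" "sorted_wrt (<) (a # w)"
      "length w = k - 2"
    using assms(3) by (elim order_isomorphic_213kE) auto
  moreover from this(4) obtain c d w' where w: "w = c # d # w'"
    using assms(3) by (cases w; cases "tl w") auto
  ultimately have less: "a < c" "c < d"
    by auto
  show False
  proof (cases v1)
    case Nil
    then have "a = l" "subseq (b # w) (M # R)"
      using abw(1) assms(2) by auto
    then have "subseq (b # w) R"
      using abw(2) l_less_M by (auto split: if_splits)
    then have "c \<in> set R" "d \<in> set R"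
      using set_subseq w by fastforce+
    then have "c = r" "d = r"
      using eq_r_if_l_less[of c] eq_r_if_l_less[of d] less \<open>a = l\<close> by auto
    then show False
      using less by simp
  next
    case (Cons a' v1')
    then have "r < a" "l < a"
      using abw(1) set_subseq[OF assms(1)] l_less_r r_less_left[of a] by auto
    then have "l \<notin> set w"
      using abw(3) by auto
    then have "subseq w (M # R)"
      using abw(1) assms(2) Cons by (auto simp: append_eq_Cons_conv)
    then have "c \<in> insert M (set R)" "d \<in> insert M (set R)"
      using set_subseq w by fastforce+
    then have "c = M" "d = M"
      using right_le_r[of c] right_le_r[of d] less \<open>r < a\<close> by auto
    then show False
      using less by simp
  qed
qed

lemma copies_213k_empty_iff:
  assumes "k \<ge> 3"
  shows "copies (pattern_213k (Suc k)) (L @ l # M # R) = {} \<longleftrightarrow>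
    copies (pattern_213k k) L = {} \<and> copies (pattern_213k (Suc k)) R = {}"
proof -
  have "\<not> order_isomorphic (v1 @ l # v2) (pattern_213k (Suc k))"
    if "subseq v1 L" "subseq v2 (M # R)" for v1 v2
    using no_copy_213k_through_l[OF that] assms by simp
  then have "copies (pattern_213k (Suc k)) (L @ l # M # R) = copies (pattern_213k (Suc k)) (L @ M # R)"
    unfolding copies_def subseq_append_Cons_iff[of _ L l] by blast
  then show ?thesis
    using copies_213k_split_empty_iff[OF peak left_above_right, of k] assms by simp
qed

lemma alternating_up_iff:
  "alternating_up (L @ l # M # R) \<longleftrightarrow> even (length L) \<and> alternating_up L \<and> alternating_up R"
proof -
  have "alternating_up ((L @ [l]) @ M # R) \<longleftrightarrow>
      odd (length (L @ [l])) \<and> alternating_up (L @ [l]) \<and> alternating_up R"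
    using peak_snoc by (rule alternating_up_peak_iff) simp
  moreover have "alternating_up (L @ [l]) \<longleftrightarrow> alternating_up L" if "even (length L)"
    using that left_all_above by (intro alternating_up_snoc_min) (auto simp: all_above_def)
  ultimately show ?thesis
    by auto
qed

lemma left_Nil_if_copies_213_empty:
  assumes "copies (pattern_213k 3) (L @ l # M # R) = {}"
  shows "L = []"
proof (rule ccontr)
  assume "L \<noteq> []"
  then have "subseq ([hd L] @ [l, M]) (L @ l # M # R)"
    by (intro list_emb_append_mono) (simp_all add: subseq_singleton_left)
  moreover have "l < hd L" "hd L < M"
    using \<open>L \<noteq> []\<close> all_aboveD[OF left_all_above] peakD[OF peak] by simp_all
  ultimately have "[hd L, l, M] \<in> copies (pattern_213k 3) (L @ l # M # R)"
    by (simp add: copies_def order_isomorphic_213_iff)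
  then show False
    using assms by simp
qed

lemma right_eq_r_if_copies_213_empty:
  assumes "copies (pattern_213k 3) (L @ l # M # R) = {}" "alternating_up R"
  shows "R = [r]"
proof -
  obtain y R' where R: "R = y # R'"
    using r_in_right by (cases R) auto
  have "y = r"
  proof (rule ccontr)
    assume "y \<noteq> r"
    then have "subseq [l, y, r] (L @ l # M # R)" "y < l"
      using R r_in_right right_less_l[of y]
      by (auto simp: subseq_singleton_left intro!: subseq_drop_many)
    then have "[l, y, r] \<in> copies (pattern_213k 3) (L @ l # M # R)"
      using l_less_r by (simp add: copies_def order_isomorphic_213_iff)
    then show False
      using assms(1) by simp
  qed
  moreover have "R' = []"
  proof (cases R')
    case (Cons z R'')
    then have "r < z" "z \<in> set R"
      using assms(2) R \<open>y = r\<close> by (simp_all add: alternating_up_Cons_Cons)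
    then show ?thesis
      using right_le_r[of z] by simp
  qed
  ultimately show ?thesis
    using R by simp
qed

end

section \<open>Decomposition of the alternating permutations\<close>

definition alt_word :: "bool \<Rightarrow> nat \<Rightarrow> nat \<Rightarrow> nat list \<Rightarrow> bool" where
  "alt_word b c k xs \<longleftrightarrow> odd (length xs) = b \<and> alternating_up xs \<and>
     card (copies pattern_132 xs) = c \<and> copies (pattern_213k k) xs = {}"

lemma order_invariant_alt_word: "order_invariant (alt_word b c k)"
proof -
  have "alt_word b c k = (\<lambda>xs. odd (length xs) = b \<and> alternating_up xs \<and>
      card (copies pattern_132 xs) = c \<and> card (copies (pattern_213k k) xs) = 0)"
    by (auto simp: alt_word_def finite_copies)
  then show ?thesis
    by (simp only:) (intro order_invariant_conj order_invariant_length order_invariant_alternating_up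
        order_invariant_card_copies)
qed

lemma alt_word_short:
  assumes "length xs \<le> 1" "k \<ge> 2"
  shows "alt_word b c k xs \<longleftrightarrow> length xs = (if b then 1 else 0) \<and> c = 0"
proof -
  have "copies pattern_132 xs = {}" "copies (pattern_213k k) xs = {}"
    using assms by (simp_all add: copies_short pattern_132_def length_pattern_213k)
  moreover have "alternating_up xs"
    using assms(1) by (simp add: alternating_up_def)
  ultimately show ?thesis
    using assms(1) by (cases xs) (auto simp: alt_word_def)
qed

lemma alt_word_split_iff:
  assumes "peak L M R" "all_above L R" "distinct (L @ M # R)" "L \<noteq> [] \<or> R \<noteq> []" "k \<ge> 2"
  shows "alt_word b c (Suc k) (L @ M # R) \<longleftrightarrow>
    (\<exists>c1 c2. c = c1 + c2 \<and> alt_word True c1 k L \<and> alt_word b c2 (Suc k) R)"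
proof -
  have "copies pattern_132 L \<inter> copies pattern_132 R = {}"
    using assms(3) by (intro copies_disjoint) (auto simp: pattern_132_def)
  then have "card (copies pattern_132 (L @ M # R)) =
      card (copies pattern_132 L) + card (copies pattern_132 R)"
    using assms(1,2) by (simp add: copies_132_split card_Un_disjoint finite_copies)
  then show ?thesis
    unfolding alt_word_def alternating_up_peak_iff[OF assms(1,4)]
      copies_213k_split_empty_iff[OF assms(1,2,5)]
    by auto
qed

lemma split_product_iff:
  assumes "peak L M R"
  shows "split_product P Q (L @ M # R) \<longleftrightarrow> all_above L R \<and> P L \<and> Q R"
  using assms peak_unique[OF assms] unfolding split_product_def by blast

lemma not_split_product_and_crossing_product: "\<not> (split_product P Q xs \<and> crossing_product P' Q' xs)"
proof
  assume "split_product P Q xs \<and> crossing_product P' Q' xs"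
  then obtain L l M r R where xs: "split_product P Q ((L @ [l]) @ M # R)" and "crossing L l M r R"
    by (auto simp: crossing_product_def)
  then interpret crossing L l M r R
    by simp
  show False
    using xs not_all_above_snoc unfolding split_product_iff[OF peak_snoc] by blast
qed

lemma length_ge_2_if_split_product_odd_left:
  "split_product (alt_word True c k) Q xs \<Longrightarrow> 2 \<le> length xs"
  by (auto simp: split_product_def alt_word_def Suc_le_eq)

lemma length_ge_3_if_crossing_product: "crossing_product P Q xs \<Longrightarrow> 3 \<le> length xs"
  using crossing.right_nonempty by (fastforce simp: crossing_product_def)

lemma alt_word_0_Suc_iff:
  assumes "distinct xs" "k \<ge> 2"
  shows "alt_word b 0 (Suc k) xs \<longleftrightarrow>
    length xs = (if b then 1 else 0) \<or> split_product (alt_word True 0 k) (alt_word b 0 (Suc k)) xs"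
proof (cases "length xs \<le> 1")
  case True
  then have "\<not> split_product (alt_word True 0 k) (alt_word b 0 (Suc k)) xs"
    by (auto dest: length_ge_2_if_split_product_odd_left)
  with True assms(2) show ?thesis
    by (simp add: alt_word_short)
next
  case False
  then have "xs \<noteq> []" "length xs \<noteq> (if b then 1 else 0)"
    by auto
  with assms(1) obtain L M R where xs: "xs = L @ M # R" and peak: "peak L M R"
    by (meson peakE)
  have ne: "L \<noteq> [] \<or> R \<noteq> []"
    using False xs by auto
  have "all_above L R" if "alt_word b 0 (Suc k) xs"
  proof (rule ccontr)
    assume "\<not> all_above L R"
    then obtain l r where "l \<in> set L" "r \<in> set R" "l < r"
      using assms(1) xs by (auto elim: not_all_aboveE)
    then have "copies pattern_132 xs \<noteq> {}"
      using peak_copy_132[OF peak] xs by blast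
    then show False
      using that by (simp add: alt_word_def finite_copies)
  qed
  then have "alt_word b 0 (Suc k) xs \<longleftrightarrow> all_above L R \<and> alt_word True 0 k L \<and> alt_word b 0 (Suc k) R"
    using alt_word_split_iff[OF peak _ _ ne assms(2), of b 0] assms(1) xs by auto
  then show ?thesis
    using \<open>length xs \<noteq> _\<close> unfolding xs split_product_iff[OF peak] by blast
qed

lemma alt_word_1_split_iff:
  assumes "peak L M R" "all_above L R" "distinct (L @ M # R)" "L \<noteq> [] \<or> R \<noteq> []" "k \<ge> 2"
  shows "alt_word b 1 (Suc k) (L @ M # R) \<longleftrightarrow>
    alt_word True 1 k L \<and> alt_word b 0 (Suc k) R \<or> alt_word True 0 k L \<and> alt_word b 1 (Suc k) R"
proof -
  have "1 = c1 + c2 \<longleftrightarrow> c1 = 1 \<and> c2 = 0 \<or> c1 = 0 \<and> c2 = 1" for c1 c2 :: nat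
    by auto
  then show ?thesis
    using alt_word_split_iff[OF assms, of b 1] by auto
qed

lemma alt_word_1_not_split_iff:
  assumes "peak L M R" "\<not> all_above L R" "distinct (L @ M # R)"
    and cross: "\<And>L l M r R. crossing L l M r R \<Longrightarrow> alt_word b 1 k (L @ l # M # R) \<longleftrightarrow> P L \<and> Q R"
  shows "alt_word b 1 k (L @ M # R) \<longleftrightarrow> crossing_product P Q (L @ M # R)"
proof
  assume alt: "alt_word b 1 k (L @ M # R)"
  then have "card (copies pattern_132 (L @ M # R)) = 1"
    by (simp add: alt_word_def)
  then obtain L' l r where L: "L = L' @ [l]" and crossing: "crossing L' l M r R"
    using assms(1-3) by (elim single_copy_132_crossingE)
  with alt cross[OF crossing] show "crossing_product P Q (L @ M # R)"
    unfolding crossing_product_def by force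
next
  assume "crossing_product P Q (L @ M # R)"
  then show "alt_word b 1 k (L @ M # R)"
    using cross unfolding crossing_product_def by force
qed

lemma alt_word_1_Suc_iff:
  assumes "distinct xs" "k \<ge> 2"
    and cross: "\<And>L l M r R. crossing L l M r R \<Longrightarrow> alt_word b 1 (Suc k) (L @ l # M # R) \<longleftrightarrow> P L \<and> Q R"
  shows "alt_word b 1 (Suc k) xs \<longleftrightarrow>
    split_product (alt_word True 1 k) (alt_word b 0 (Suc k)) xs \<or>
    split_product (alt_word True 0 k) (alt_word b 1 (Suc k)) xs \<or> crossing_product P Q xs"
proof (cases "length xs \<le> 1")
  case True
  then have "\<not> split_product (alt_word True 1 k) (alt_word b 0 (Suc k)) xs"
      "\<not> split_product (alt_word True 0 k) (alt_word b 1 (Suc k)) xs" "\<not> crossing_product P Q xs"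
    by (auto dest!: length_ge_2_if_split_product_odd_left length_ge_3_if_crossing_product)
  with True assms(2) show ?thesis
    by (simp add: alt_word_short)
next
  case False
  then have "xs \<noteq> []" by auto
  with assms(1) obtain L M R where xs: "xs = L @ M # R" and peak: "peak L M R"
    by (rule peakE)
  show ?thesis
  proof (cases "all_above L R")
    case True
    have "alt_word b 1 (Suc k) (L @ M # R) \<longleftrightarrow>
        alt_word True 1 k L \<and> alt_word b 0 (Suc k) R \<or> alt_word True 0 k L \<and> alt_word b 1 (Suc k) R"
      using peak True assms(1,2) xs False by (intro alt_word_1_split_iff) auto
    moreover have "split_product (\<lambda>_. True) (\<lambda>_. True) (L @ M # R)"
      using True by (simp add: split_product_iff[OF peak])
    then have "\<not> crossing_product P Q (L @ M # R)"
      using not_split_product_and_crossing_product by blast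
    ultimately show ?thesis
      unfolding xs split_product_iff[OF peak] using True by blast
  next
    case False
    then have "alt_word b 1 (Suc k) xs \<longleftrightarrow> crossing_product P Q xs"
      using alt_word_1_not_split_iff[OF peak _ _ cross] assms(1) xs by simp
    then show ?thesis
      unfolding xs split_product_iff[OF peak] using False by blast
  qed
qed

lemma alt_word_crossing_iff:
  assumes "crossing L l M r R" "k \<ge> 3"
  shows "alt_word b 1 (Suc k) (L @ l # M # R) \<longleftrightarrow> alt_word False 0 k L \<and> alt_word b 0 (Suc k) R"
proof -
  interpret crossing L l M r R by fact
  show ?thesis
    unfolding alt_word_def alternating_up_iff card_copies_132_eq_1_iff copies_213k_empty_iff[OF assms(2)]
    by (auto simp: finite_copies)
qed

lemma alt_word_3_crossing_iff:
  assumes "crossing L l M r R"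
  shows "alt_word b 1 3 (L @ l # M # R) \<longleftrightarrow> L = [] \<and> b \<and> length R = 1"
proof -
  interpret crossing L l M r R by fact
  show ?thesis
  proof
    assume alt: "alt_word b 1 3 (L @ l # M # R)"
    then have "L = []" "R = [r]"
      using left_Nil_if_copies_213_empty right_eq_r_if_copies_213_empty
      by (simp_all add: alt_word_def alternating_up_iff)
    then show "L = [] \<and> b \<and> length R = 1"
      using alt by (simp add: alt_word_def)
  next
    assume short: "L = [] \<and> b \<and> length R = 1"
    then have R: "R = [r]"
      using r_in_right by (cases R) auto
    have "copies (pattern_213k 3) [l, M, r] = {}"
      using l_less_M subseq_same_length[of _ "[l, M, r]"]
      by (fastforce simp: copies_def order_isomorphic_213_iff)
    moreover have "card (copies pattern_132 (L @ l # M # R)) = 1"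
      unfolding card_copies_132_eq_1_iff using short R by (simp add: copies_short pattern_132_def)
    moreover have "alternating_up (L @ l # M # R)"
      unfolding alternating_up_iff using short R by (simp add: alternating_up_Nil alternating_up_single)
    ultimately show "alt_word b 1 3 (L @ l # M # R)"
      using short R by (simp add: alt_word_def)
  qed
qed

section \<open>Recurrences for the generating functions\<close>

text \<open>\<open>A\<^sub>k\<close>, \<open>C\<^sub>k\<close> and \<open>D\<^sub>k\<close> are \<open>alt_gf True 0 k\<close>, \<open>alt_gf True 1 k\<close> and \<open>alt_gf False 1 k\<close>.\<close>

definition alt_gf :: "bool \<Rightarrow> nat \<Rightarrow> nat \<Rightarrow> rat fls" where
  "alt_gf b c k = fps_to_fls (perm_gf (alt_word b c k))"

lemma alt_word_odd_2_iff: "alt_word True c 2 xs \<longleftrightarrow> length xs = 1 \<and> c = 0"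
proof (cases "length xs \<le> 1")
  case False
  have "\<not> alt_word True c 2 xs"
  proof
    assume alt: "alt_word True c 2 xs"
    with False have "3 \<le> length xs"
      by (cases "length xs = 2") (auto simp: alt_word_def)
    then obtain x y z zs where xs: "xs = x # y # z # zs"
      by (auto simp: Suc_le_length_iff numeral_3_eq_3)
    then have "z < y"
      using alt by (simp add: alt_word_def alternating_up_Cons_Cons)
    then have "[y, z] \<in> copies (pattern_213k 2) xs"
      by (simp add: copies_def xs order_isomorphic_def pattern_213k_2 All_less_Suc)
    then show False
      using alt by (simp add: alt_word_def)
  qed
  with False show ?thesis by simp
qed (simp add: alt_word_short)

lemma alt_gf_odd_2: "alt_gf True c 2 = (if c = 0 then fls_X else 0)"
proof -
  have "alt_word True c 2 = (\<lambda>xs. length xs = 1 \<and> c = 0)"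
    by (simp add: fun_eq_iff alt_word_odd_2_iff)
  then show ?thesis
    by (simp add: alt_gf_def perm_gf_length_eq perm_gf_False)
qed

lemma alt_gf_0_Suc:
  assumes "k \<ge> 2"
  shows "alt_gf b 0 (Suc k) = (if b then fls_X else 1) + fls_X * alt_gf True 0 k * alt_gf b 0 (Suc k)"
proof -
  let ?S = "split_product (alt_word True 0 k) (alt_word b 0 (Suc k))"
  have "perm_gf (alt_word b 0 (Suc k)) = perm_gf (\<lambda>xs. length xs = (if b then 1 else 0) \<or> ?S xs)"
    using assms by (intro perm_gf_cong alt_word_0_Suc_iff)
  also have "\<dots> = perm_gf (\<lambda>xs. length xs = (if b then 1 else 0)) + perm_gf ?S"
    by (intro perm_gf_disj) (auto dest: length_ge_2_if_split_product_odd_left split: if_splits)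
  also have "\<dots> = (if b then fps_X else 1) +
      fps_X * perm_gf (alt_word True 0 k) * perm_gf (alt_word b 0 (Suc k))"
    unfolding perm_gf_length_eq by (simp add: perm_gf_split_product order_invariant_alt_word)
  finally have "fps_to_fls (perm_gf (alt_word b 0 (Suc k)) :: rat fps) =
      fps_to_fls ((if b then fps_X else 1) +
        fps_X * perm_gf (alt_word True 0 k) * perm_gf (alt_word b 0 (Suc k)))"
    by (rule arg_cong)
  then show ?thesis
    by (cases b) (simp_all add: alt_gf_def fls_times_fps_to_fls)
qed

lemma alt_gf_1_Suc_if_crossing:
  assumes "k \<ge> 2" "order_invariant P" "order_invariant Q"
    and cross: "\<And>L l M r R. crossing L l M r R \<Longrightarrow> alt_word b 1 (Suc k) (L @ l # M # R) \<longleftrightarrow> P L \<and> Q R"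
  shows "alt_gf b 1 (Suc k) =
    fls_X * alt_gf True 1 k * alt_gf b 0 (Suc k) + fls_X * alt_gf True 0 k * alt_gf b 1 (Suc k) +
    fls_X\<^sup>2 * fps_to_fls (perm_gf P) * (fps_to_fls (perm_gf Q) - (if Q [] then 1 else 0))"
proof -
  let ?S = "split_product (alt_word True 1 k) (alt_word b 0 (Suc k))"
  let ?T = "split_product (alt_word True 0 k) (alt_word b 1 (Suc k))"
  let ?C = "crossing_product P Q"
  have "\<not> (?S xs \<and> ?T xs)" for xs
    unfolding split_product_def alt_word_def by (metis peak_unique(1) zero_neq_one)
  then have "perm_gf (\<lambda>xs. ?S xs \<or> ?T xs \<or> ?C xs) =
      (perm_gf ?S + perm_gf (\<lambda>xs. ?T xs \<or> ?C xs) :: rat fps)"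
    using not_split_product_and_crossing_product by (intro perm_gf_disj) blast
  also have "perm_gf (\<lambda>xs. ?T xs \<or> ?C xs) = (perm_gf ?T + perm_gf ?C :: rat fps)"
    using not_split_product_and_crossing_product by (rule perm_gf_disj)
  also have "perm_gf (\<lambda>xs. ?S xs \<or> ?T xs \<or> ?C xs) = (perm_gf (alt_word b 1 (Suc k)) :: rat fps)"
    using assms(1) cross by (intro perm_gf_cong[symmetric] alt_word_1_Suc_iff)
  finally have "fps_to_fls (perm_gf (alt_word b 1 (Suc k)) :: rat fps) =
      fps_to_fls (perm_gf ?S + (perm_gf ?T + perm_gf ?C))"
    by (rule arg_cong)
  then show ?thesis
    by (cases "Q []") (simp_all add: alt_gf_def perm_gf_split_product perm_gf_crossing_product
        order_invariant_alt_word assms(2,3) fls_times_fps_to_fls fps_to_fls_power add.assoc)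
qed

lemma alt_gf_1_3: "alt_gf b 1 3 = fls_X\<^sup>2 * alt_gf b 1 3 + (if b then fls_X ^ 3 else 0)"
proof -
  have "order_invariant (\<lambda>L. L = [])"
    using order_invariant_length[of "\<lambda>m. m = 0"] by simp
  moreover have "order_invariant (\<lambda>R. b \<and> length R = 1)"
    by (rule order_invariant_length)
  moreover have three: "Suc 2 = 3"
    by simp
  ultimately have "alt_gf b 1 3 =
      fls_X * alt_gf True 1 2 * alt_gf b 0 3 + fls_X * alt_gf True 0 2 * alt_gf b 1 3 +
      fls_X\<^sup>2 * fps_to_fls (perm_gf (\<lambda>L. L = [])) * fps_to_fls (perm_gf (\<lambda>R. b \<and> length R = 1))"
    using alt_gf_1_Suc_if_crossing[OF order.refl, of "\<lambda>L. L = []" "\<lambda>R. b \<and> length R = 1" b,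
        unfolded three, OF _ _ alt_word_3_crossing_iff] by simp
  moreover have "fps_to_fls (perm_gf (\<lambda>L. L = []) :: rat fps) = 1"
    using perm_gf_length_eq[of 0] by simp
  moreover have "fps_to_fls (perm_gf (\<lambda>R. b \<and> length R = 1) :: rat fps) = (if b then fls_X else 0)"
    by (simp add: perm_gf_length_eq perm_gf_False)
  ultimately show ?thesis
    by (cases b) (simp_all add: alt_gf_odd_2 power2_eq_square power3_eq_cube mult.assoc)
qed

lemma alt_gf_1_Suc:
  assumes "k \<ge> 3"
  shows "alt_gf b 1 (Suc k) =
    fls_X * alt_gf True 1 k * alt_gf b 0 (Suc k) + fls_X * alt_gf True 0 k * alt_gf b 1 (Suc k) +
    fls_X\<^sup>2 * alt_gf False 0 k * (alt_gf b 0 (Suc k) - (if b then 0 else 1))"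
proof -
  have "alt_word b 0 (Suc k) [] \<longleftrightarrow> \<not> b"
    using assms by (simp add: alt_word_short)
  moreover have "k \<ge> 2"
    using assms by simp
  ultimately show ?thesis
    using alt_gf_1_Suc_if_crossing[where b = b, OF _ order_invariant_alt_word order_invariant_alt_word
        alt_word_crossing_iff[OF _ assms]]
    by (cases b) (simp_all flip: alt_gf_def)
qed

lemma alt_gf_odd_0_Suc:
  assumes "k \<ge> 2"
  shows "alt_gf True 0 (Suc k) = fls_X + fls_X * alt_gf True 0 k * alt_gf True 0 (Suc k)"
  using alt_gf_0_Suc[OF assms, of True] by simp

lemma alt_gf_even_0_Suc:
  assumes "k \<ge> 2"
  shows "alt_gf False 0 (Suc k) * (1 - fls_X * alt_gf True 0 k) = 1"
  using alt_gf_0_Suc[OF assms, of False] by simp algebra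

lemma X_alt_gf_even_0:
  assumes "k \<ge> 3"
  shows "fls_X * alt_gf False 0 k = alt_gf True 0 k"
proof -
  obtain m where k: "k = Suc m" and "m \<ge> 2"
    using assms by (cases k) auto
  show ?thesis
    unfolding k using alt_gf_odd_0_Suc[OF \<open>m \<ge> 2\<close>] alt_gf_even_0_Suc[OF \<open>m \<ge> 2\<close>] by algebra
qed

lemma alt_gf_odd_1_3: "alt_gf True 1 3 = fls_X\<^sup>2 * alt_gf True 0 3"
proof -
  have "alt_gf False 0 3 * (1 - fls_X * fls_X) = 1"
    using alt_gf_even_0_Suc[of 2] by (simp add: alt_gf_odd_2)
  then show ?thesis
    using X_alt_gf_even_0[of 3] alt_gf_1_3[of True] by simp algebra
qed

lemma alt_gf_even_1_3: "alt_gf False 1 3 = 0"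
proof -
  have "alt_gf False 0 3 * (1 - fls_X * fls_X) = 1"
    using alt_gf_even_0_Suc[of 2] by (simp add: alt_gf_odd_2)
  moreover have "alt_gf False 1 3 = fls_X\<^sup>2 * alt_gf False 1 3"
    using alt_gf_1_3[of False] by (simp only: if_False add_0_right)
  ultimately show ?thesis
    by algebra
qed

lemma alt_gf_odd_1_Suc:
  assumes "k \<ge> 3"
  shows "alt_gf True 1 (Suc k) = (alt_gf True 0 (Suc k))\<^sup>2 * (alt_gf True 1 k + alt_gf True 0 k)"
proof -
  have "alt_gf False 0 (Suc k) * (1 - fls_X * alt_gf True 0 k) = 1"
    using assms by (intro alt_gf_even_0_Suc) simp
  then show ?thesis
    using alt_gf_1_Suc[OF assms, of True] X_alt_gf_even_0[OF assms] X_alt_gf_even_0[of "Suc k"] assms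
    by simp algebra
qed

lemma X_alt_gf_even_1_Suc:
  assumes "k \<ge> 2"
  shows "fls_X * alt_gf False 1 (Suc k) =
    alt_gf True 1 (Suc k) - fls_X * alt_gf True 0 k * alt_gf True 0 (Suc k)"
proof (cases "k = 2")
  case True
  then show ?thesis
    by (simp add: alt_gf_even_1_3 alt_gf_odd_1_3 alt_gf_odd_2 power2_eq_square flip: One_nat_def)
next
  case False
  with assms have "k \<ge> 3"
    by simp
  then show ?thesis
    using alt_gf_even_0_Suc[OF assms] X_alt_gf_even_0[of k] X_alt_gf_even_0[of "Suc k"]
      alt_gf_1_Suc[of k True] alt_gf_1_Suc[of k False] by simp algebra
qed

section \<open>Chebyshev polynomials\<close>

lemma cheb_U_cassini:
  assumes "r \<ge> 0"
  shows "(cheb_U r)\<^sup>2 - cheb_U (r - 1) * cheb_U (r + 1) = (1 :: 'a::comm_ring_1 poly)"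
  using assms
proof (induction r rule: int_ge_induct)
  case base
  show ?case
    by (simp add: cheb_U_minus_1 cheb_U_0)
next
  case (step r)
  define t :: "'a poly" where "t = [:0, 2:]"
  have rec: "cheb_U (r + 1) - t * cheb_U r = - cheb_U (r - 1)"
    "cheb_U (r + 2) = t * cheb_U (r + 1) - cheb_U r"
    using step.hyps by (subst cheb_U_rec; simp add: t_def)+
  have "(cheb_U (r + 1))\<^sup>2 - cheb_U r * cheb_U (r + 2) =
      cheb_U (r + 1) * (cheb_U (r + 1) - t * cheb_U r) + (cheb_U r)\<^sup>2"
    by (simp add: rec(2) algebra_simps power2_eq_square)
  also have "\<dots> = (cheb_U r)\<^sup>2 - cheb_U (r - 1) * cheb_U (r + 1)"
    by (simp add: rec(1) mult.commute)
  finally show ?case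
    using step.IH by (simp add: add.assoc)
qed

lemma Uhat_minus_1: "Uhat (-1) = 0"
  and Uhat_0: "Uhat 0 = 1"
  by (simp_all add: Uhat_def cheb_U_minus_1 cheb_U_0)

lemma Uhat_rec:
  assumes "r \<ge> 0"
  shows "Uhat r = fls_X * (Uhat (r + 1) + Uhat (r - 1))"
proof -
  define y :: "rat fls" where "y = 1 / (2 * fls_X)"
  have "2 * fls_X * y = 1"
    by (simp add: y_def)
  moreover have "Uhat (r + 1) = 2 * y * Uhat r - Uhat (r - 1)"
    unfolding Uhat_def y_def[symmetric] using assms by (subst cheb_U_rec) (simp_all add: mult_ac)
  ultimately show ?thesis
    by algebra
qed

lemma Uhat_cassini:
  assumes "r \<ge> 0"
  shows "(Uhat r)\<^sup>2 - Uhat (r - 1) * Uhat (r + 1) = 1"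
  using arg_cong[OF cheb_U_cassini[OF assms], of "\<lambda>p. poly p (1 / (2 * fls_X :: rat fls))"]
  by (simp add: Uhat_def)

lemma alt_gf_odd_0_eq_Uhat:
  assumes "k \<ge> 2"
  shows "Uhat (int k - 1) \<noteq> 0" "alt_gf True 0 k = Uhat (int k - 2) / Uhat (int k - 1)"
  using assms
proof (induction k rule: nat_induct_at_least)
  case base
  have "1 = fls_X * Uhat 1"
    using Uhat_rec[of 0] by (simp add: Uhat_0 Uhat_minus_1)
  then have "Uhat 1 \<noteq> 0" "fls_X = 1 / Uhat 1"
    by (auto simp: eq_divide_eq)
  then show "Uhat (int 2 - 1) \<noteq> 0" "alt_gf True 0 2 = Uhat (int 2 - 2) / Uhat (int 2 - 1)"
    by (simp_all add: alt_gf_odd_2 Uhat_0)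
next
  case (Suc k)
  let ?U = "Uhat (int k)" and ?V = "Uhat (int k - 1)" and ?W = "Uhat (int k - 2)" and ?A = "alt_gf True 0"
  have VW: "?V = fls_X * (?U + ?W)"
    using Uhat_rec[of "int k - 1"] Suc.hyps by simp
  have AV: "?A k * ?V = ?W"
    using Suc.IH by simp
  have "fls_X * ?U = ?V - fls_X * ?W"
    using VW by (simp add: distrib_left)
  also have "\<dots> = (1 - fls_X * ?A k) * ?V"
    by (simp add: left_diff_distrib mult.assoc AV)
  finally have U_step: "fls_X * ?U = (1 - fls_X * ?A k) * ?V" .
  have A_step: "?A (Suc k) * (1 - fls_X * ?A k) = fls_X"
    using alt_gf_odd_0_Suc[OF Suc.hyps] by algebra
  have "fls_X * (?A (Suc k) * ?U) = ?A (Suc k) * (fls_X * ?U)"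
    by (simp only: mult.left_commute)
  also have "\<dots> = ?A (Suc k) * (1 - fls_X * ?A k) * ?V"
    by (simp only: U_step mult.assoc)
  finally have "fls_X * (?A (Suc k) * ?U) = fls_X * ?V"
    by (simp only: A_step)
  then have "?A (Suc k) * ?U = ?V"
    by simp
  moreover from this have "?U \<noteq> 0"
    using Suc.IH(1) by auto
  ultimately show "Uhat (int (Suc k) - 1) \<noteq> 0"
    "alt_gf True 0 (Suc k) = Uhat (int (Suc k) - 2) / Uhat (int (Suc k) - 1)"
    by (simp_all add: field_simps)
qed

lemma sum_int_Suc:
  fixes f :: "int \<Rightarrow> 'a :: comm_monoid_add"
  assumes "m \<ge> 0"
  shows "(\<Sum>i = 0..m. f i) = (\<Sum>i = 0..m - 1. f i) + f m"
proof -
  have "{0..m} = insert m {0..m - 1}"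
    using assms by auto
  then show ?thesis
    by (simp add: add.commute)
qed

lemma alt_gf_odd_1_Uhat:
  assumes "k \<ge> 3"
  shows "alt_gf True 1 k * (Uhat (int k - 1))\<^sup>2 = (\<Sum>j = 0..int k - 3. Uhat (j + 1) * Uhat j) - fls_X"
  using assms
proof (induction k rule: nat_induct_at_least)
  case base
  have "alt_gf True 0 3 * Uhat 2 = Uhat 1"
    using alt_gf_odd_0_eq_Uhat[of 3] by simp
  moreover have "1 = fls_X * Uhat 1" "Uhat 1 = fls_X * (Uhat 2 + 1)"
    using Uhat_rec[of 0] Uhat_rec[of 1] by (simp_all add: Uhat_0 Uhat_minus_1)
  ultimately have "alt_gf True 1 3 * (Uhat 2)\<^sup>2 = Uhat 1 - fls_X"
    unfolding alt_gf_odd_1_3 by algebra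
  then show ?case
    by (simp add: Uhat_0)
next
  case (Suc k)
  let ?U = "Uhat (int k)" and ?V = "Uhat (int k - 1)" and ?W = "Uhat (int k - 2)"
  have "alt_gf True 0 (Suc k) * ?U = ?V" "alt_gf True 0 k * ?V = ?W"
    using alt_gf_odd_0_eq_Uhat[of "Suc k"] alt_gf_odd_0_eq_Uhat[of k] Suc.hyps by simp_all
  moreover have "alt_gf True 1 (Suc k) * ?U\<^sup>2 =
      (alt_gf True 0 (Suc k) * ?U)\<^sup>2 * (alt_gf True 1 k + alt_gf True 0 k)"
    unfolding alt_gf_odd_1_Suc[OF Suc.hyps] by (simp only: power_mult_distrib mult_ac)
  ultimately have "alt_gf True 1 (Suc k) * ?U\<^sup>2 = alt_gf True 1 k * ?V\<^sup>2 + ?V * ?W"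
    by (simp add: power2_eq_square algebra_simps)
  also have "\<dots> = (\<Sum>j = 0..int (Suc k) - 3. Uhat (j + 1) * Uhat j) - fls_X"
    using Suc.IH Suc.hyps sum_int_Suc[of "int k - 2" "\<lambda>j. Uhat (j + 1) * Uhat j"] by simp
  finally show ?case
    by simp
qed

lemma alt_gf_even_1_Uhat:
  assumes "k \<ge> 3"
  shows "alt_gf False 1 k * (fls_X * (Uhat (int k - 1))\<^sup>2) =
    fls_X * Uhat (int k - 4) * Uhat (int k - 2) + (\<Sum>j = 0..int k - 4. Uhat j * Uhat (j + 1))"
proof -
  obtain m where k: "k = Suc m" and "m \<ge> 2"
    using assms by (cases k) auto
  let ?A = "alt_gf True 0"
  have A: "?A k * Uhat (int k - 1) = Uhat (int k - 2)" "?A m * Uhat (int k - 2) = Uhat (int k - 3)"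
    using alt_gf_odd_0_eq_Uhat[of k] alt_gf_odd_0_eq_Uhat[of m] assms k by simp_all
  have "fls_X * alt_gf False 1 k = alt_gf True 1 k - fls_X * ?A m * ?A k"
    using X_alt_gf_even_1_Suc[OF \<open>m \<ge> 2\<close>] k by simp
  then have "alt_gf False 1 k * (fls_X * (Uhat (int k - 1))\<^sup>2) =
     (\<Sum>j = 0..int k - 3. Uhat (j + 1) * Uhat j) - fls_X - fls_X * Uhat (int k - 3) * Uhat (int k - 1)"
    using A alt_gf_odd_1_Uhat[OF assms] by algebra
  also have "(\<Sum>j = 0..int k - 3. Uhat (j + 1) * Uhat j) =
      (\<Sum>j = 0..int k - 4. Uhat j * Uhat (j + 1)) + Uhat (int k - 3) * Uhat (int k - 2)"
    using sum_int_Suc[of "int k - 3" "\<lambda>j. Uhat (j + 1) * Uhat j"] assms by (simp add: mult.commute)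
  finally show ?thesis
    using Uhat_cassini[of "int k - 3"] Uhat_rec[of "int k - 2"] assms by simp algebra
qed

lemma up_down_patterns_iff_alt_word:
  assumes "\<pi> \<in> permutations_of_set {1..n}" "k \<ge> 2"
  shows "up_down \<pi> \<and> contains_exactly_once \<pi> pattern_132 \<and> avoids \<pi> (pattern_213k k) \<longleftrightarrow>
      alt_word True 1 k \<pi>"
    and "up_up \<pi> \<and> contains_exactly_once \<pi> pattern_132 \<and> avoids \<pi> (pattern_213k k) \<longleftrightarrow>
      alt_word False 1 k \<pi>"
proof -
  have "distinct \<pi>"
    using assms(1) by (rule permutations_of_setD)
  moreover have "length \<pi> \<ge> 2" if "alt_word b 1 k \<pi>" for b
    using that alt_word_short[of \<pi> k b 1] assms(2) by (cases "length \<pi> \<le> 1") auto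
  ultimately show
    "up_down \<pi> \<and> contains_exactly_once \<pi> pattern_132 \<and> avoids \<pi> (pattern_213k k) \<longleftrightarrow> alt_word True 1 k \<pi>"
    "up_up \<pi> \<and> contains_exactly_once \<pi> pattern_132 \<and> avoids \<pi> (pattern_213k k) \<longleftrightarrow> alt_word False 1 k \<pi>"
    unfolding alt_word_def up_down_def up_up_def
    by (auto simp: contains_exactly_once_iff_card_copies avoids_iff_copies_empty)
qed

lemma ud_eq_num_perms: "k \<ge> 2 \<Longrightarrow> ud k n = num_perms (alt_word True 1 k) n"
  and uu_eq_num_perms: "k \<ge> 2 \<Longrightarrow> uu k n = num_perms (alt_word False 1 k) n"
  by (simp_all add: ud_def uu_def num_perms_def up_down_patterns_iff_alt_word cong: conj_cong)

theorem theorem4p7: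
  fixes k :: nat
  assumes "k \<ge> 3"
  shows "fps_to_fls (Abs_fps (\<lambda>n. of_nat (ud k n) :: rat)) =
           1 / (Uhat (int k - 1))\<^sup>2 * ((\<Sum>j = 0..int k - 3. Uhat (j + 1) * Uhat j) - fls_X) \<and>
         fps_to_fls (Abs_fps (\<lambda>n. of_nat (uu k n) :: rat)) =
           1 / (fls_X * (Uhat (int k - 1))\<^sup>2) *
             (fls_X * Uhat (int k - 4) * Uhat (int k - 2) + (\<Sum>j = 0..int k - 4. Uhat j * Uhat (j + 1)))"
proof -
  let ?U = "Uhat (int k - 1)"
  have gf: "fps_to_fls (Abs_fps (\<lambda>n. of_nat (ud k n) :: rat)) = alt_gf True 1 k"
    "fps_to_fls (Abs_fps (\<lambda>n. of_nat (uu k n) :: rat)) = alt_gf False 1 k"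
    using assms by (simp_all add: alt_gf_def perm_gf_def ud_eq_num_perms uu_eq_num_perms)
  have "?U \<noteq> 0"
    using assms by (intro alt_gf_odd_0_eq_Uhat) simp
  then have "?U\<^sup>2 \<noteq> 0" "fls_X * ?U\<^sup>2 \<noteq> 0"
    by simp_all
  moreover have "c = 1 / a * b" if "a \<noteq> 0" "c * a = b" for a b c :: "rat fls"
    using that by auto
  ultimately show ?thesis
    unfolding gf using alt_gf_odd_1_Uhat[OF assms] alt_gf_even_1_Uhat[OF assms] by blast
qed

end
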